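(* Let $(\mathcal{E},D(\mathcal{E}))$ be a transient symmetric regular Dirichlet form on $L^2(E;m)$ with generator $L$, let $\mu\in\mathcal{M}_{0,b}$ be a diffuse measure and let $f:E\times\mathbb{R}\to\mathbb{R}$ be a Carathéodory function such that $$(f(x,y_1)-f(x,y_2))(y_1-y_2)\le0,\qquad x\in E,\ y_1,y_2\in\mathbb{R}.$$ Then there exists at most one solution (in the sense of duality) of the equation $-Lu=f(\cdot,u)+\mu$; that is, any two solutions are equal $m$-a.e.
   Context: Setting. $E$ is a locally compact separable metric space; $m$ is a Radon measure on $E$ (nonnegative Borel measure, finite on compact sets) with $\mathrm{supp}[m]=E$; $(\cdot,\cdot)$ is the inner product of $L^2(E;m)$. $(\mathcal{E},D(\mathcal{E}))$ is a symmetric regular Dirichlet form on $L^2(E;m)$ which is transient: there is a bounded $g\in L^1(E;m)$, $g>0$ $m$-a.e., with $\int_E|u|g\,dm\le\mathcal{E}(u,u)^{1/2}$ for all $u\in D(\mathcal{E})$. $L$ is the unique nonpositive self-adjoint operator on $L^2(E;m)$ with $D(L)\subset D(\mathcal{E})$ and $\mathcal{E}(u,v)=(-Lu,v)$ for $u\in D(L)$, $v\in D(\mathcal{E})$. The extended Dirichlet space $D_e(\mathcal{E})$ consists of ($m$-classes of) $m$-a.e. finite measurable functions $u$ that are $m$-a.e. limits of $\mathcal{E}$-Cauchy sequences $\{u_n\}\subset D(\mathcal{E})$, with $\mathcal{E}(u,u)=\lim_n\mathcal{E}(u_n,u_n)$. Capacity. For $U\subset E$ open, $\mathrm{Cap}_{(0)}(U)=\inf\{\mathcal{E}(u,u):u\in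 D_e(\mathcal{E}),\,u\ge1\ m\text{-a.e. on }U\}$ ($\inf\emptyset=\infty$); for arbitrary $A\subset E$, $\mathrm{Cap}_{(0)}(A)=\inf\{\mathrm{Cap}_{(0)}(U):U\supset A\text{ open}\}$. A function is quasi-continuous if for every $\varepsilon>0$ there is an open $U$ with $\mathrm{Cap}_{(0)}(U)<\varepsilon$ such that its restriction to $E\setminus U$ is continuous. $\tilde u$ denotes a quasi-continuous $m$-version of $u$. Measures. $\mathcal{M}_{0,b}$ is the space of finite signed Borel measures on $E$ charging no set of $\mathrm{Cap}_{(0)}$ zero (diffuse measures). Potentials. $(G_\alpha)_{\alpha>0}$ is the $L^2(E;m)$-resolvent of $\mathcal{E}$, extended to nonnegative Borel functions by monotone limits; for nonnegative Borel $\eta$, $G\eta=\sup_{\alpha>0}G_\alpha\eta$ $m$-a.e.; for signed $\eta$ with $G|\eta|<\infty$ $m$-a.e., $G\eta=G\eta^+-G\eta^-$. For $\eta\in L^1(E;m)$, $G\eta$ has a quasi-continuous $m$-version $\widetilde{G\eta}$. Carathéodory: $f(\cdot,y)$ is measurable for each $y$, and $f(x,\cdot)$ is continuous for each $x$. Solution. $u:E\to\mathbb{R}$ (measurable) is a solution of $-Lu=f(\cdot,u)+\mu$ in the sense of duality if (a) $f(\cdot,u)\in L^1(E;m)$, and (b) for every $\eta\in L^1(E;m)$ such that $G|\eta|$ is bounded, $$\int_E u\,\eta\,dm=\int_E f(x,u(x))\,G\eta(x)\,m(dx)+\int_E\widetilde{G\eta}\,d\mu .$$ *)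

theory Defs
  imports "HOL-Analysis.Analysis"
begin

text \<open>Elements of \<open>L\<^sup>2(E;m)\<close>, of the form domain and of the extended Dirichlet space are represented
  by Borel functions \<open>E \<Rightarrow> \<real>\<close>; sets of such functions are saturated under equality \<open>m\<close>-a.e.\<close>

section \<open>Radon measures with full support\<close>

definition radon_measure :: "'a::topological_space measure \<Rightarrow> bool" where
  "radon_measure m \<longleftrightarrow> sets m = sets borel \<and> (\<forall>K. compact K \<longrightarrow> emeasure m K < \<infinity>)"

definition measure_support :: "'a::topological_space measure \<Rightarrow> 'a set" where
  "measure_support m = {x. \<forall>U. open U \<and> x \<in> U \<longrightarrow> emeasure m U > 0}"

section \<open>Dirichlet forms\<close>

definition L2 :: "'a measure \<Rightarrow> ('a \<Rightarrow> real) set" where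
  "L2 m = {u \<in> borel_measurable m. integrable m (\<lambda>x. (u x)\<^sup>2)}"

definition L2_inner :: "'a measure \<Rightarrow> ('a \<Rightarrow> real) \<Rightarrow> ('a \<Rightarrow> real) \<Rightarrow> real" where
  "L2_inner m u v = (\<integral>x. u x * v x \<partial>m)"

definition form_energy :: "(('a \<Rightarrow> real) \<Rightarrow> ('a \<Rightarrow> real) \<Rightarrow> real) \<Rightarrow> ('a \<Rightarrow> real) \<Rightarrow> real" where
  "form_energy \<E> u = \<E> u u"

text \<open>The quadratic form of \<open>\<E>\<^sub>1(u,v) = \<E>(u,v) + (u,v)\<close>.\<close>

definition form_energy1 ::
  "'a measure \<Rightarrow> (('a \<Rightarrow> real) \<Rightarrow> ('a \<Rightarrow> real) \<Rightarrow> real) \<Rightarrow> ('a \<Rightarrow> real) \<Rightarrow> real" where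
  "form_energy1 m \<E> u = \<E> u u + L2_inner m u u"

definition form_Cauchy :: "(('a \<Rightarrow> real) \<Rightarrow> real) \<Rightarrow> (nat \<Rightarrow> 'a \<Rightarrow> real) \<Rightarrow> bool" where
  "form_Cauchy q us \<longleftrightarrow>
     (\<forall>\<epsilon>>0. \<exists>N. \<forall>i\<ge>N. \<forall>j\<ge>N. q (\<lambda>x. us i x - us j x) < \<epsilon>)"

locale symmetric_dirichlet_form =
  fixes m :: "'a measure"
    and D :: "('a \<Rightarrow> real) set"
    and \<E> :: "('a \<Rightarrow> real) \<Rightarrow> ('a \<Rightarrow> real) \<Rightarrow> real"
  assumes dom_L2: "D \<subseteq> L2 m"
    and dom_saturated:
      "\<lbrakk>u \<in> D; v \<in> borel_measurable m; AE x in m. u x = v x\<rbrakk> \<Longrightarrow> v \<in> D"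
    and dom_zero: "(\<lambda>x. 0) \<in> D"
    and dom_add: "\<lbrakk>u \<in> D; v \<in> D\<rbrakk> \<Longrightarrow> (\<lambda>x. u x + v x) \<in> D"
    and dom_scale: "u \<in> D \<Longrightarrow> (\<lambda>x. c * u x) \<in> D"
    and dom_dense:
      "\<lbrakk>h \<in> L2 m; \<epsilon> > 0\<rbrakk> \<Longrightarrow> \<exists>u\<in>D. L2_inner m (\<lambda>x. h x - u x) (\<lambda>x. h x - u x) < \<epsilon>"
    and form_cong:
      "\<lbrakk>u \<in> D; u' \<in> D; v \<in> D; AE x in m. u x = u' x\<rbrakk> \<Longrightarrow> \<E> u v = \<E> u' v"
    and form_add:
      "\<lbrakk>u \<in> D; u' \<in> D; v \<in> D\<rbrakk> \<Longrightarrow> \<E> (\<lambda>x. u x + u' x) v = \<E> u v + \<E> u' v"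
    and form_scale: "\<lbrakk>u \<in> D; v \<in> D\<rbrakk> \<Longrightarrow> \<E> (\<lambda>x. c * u x) v = c * \<E> u v"
    and form_sym: "\<lbrakk>u \<in> D; v \<in> D\<rbrakk> \<Longrightarrow> \<E> u v = \<E> v u"
    and form_nonneg: "u \<in> D \<Longrightarrow> \<E> u u \<ge> 0"
    and form_closed:
      "\<lbrakk>\<And>n. us n \<in> D; form_Cauchy (form_energy1 m \<E>) us\<rbrakk> \<Longrightarrow>
        \<exists>u\<in>D. (\<lambda>n. form_energy1 m \<E> (\<lambda>x. us n x - u x)) \<longlonglongrightarrow> 0"
    and form_markov:
      "u \<in> D \<Longrightarrow> (\<lambda>x. min (max (u x) 0) 1) \<in> D \<and>
         \<E> (\<lambda>x. min (max (u x) 0) 1) (\<lambda>x. min (max (u x) 0) 1) \<le> \<E> u u"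

definition Cc :: "('a::topological_space \<Rightarrow> real) set" where
  "Cc = {\<phi>. continuous_on UNIV \<phi> \<and> compact (closure {x. \<phi> x \<noteq> 0})}"

locale regular_symmetric_dirichlet_form = symmetric_dirichlet_form m D \<E>
  for m :: "'a::topological_space measure" and D \<E> +
  assumes core_dense_form:
      "\<lbrakk>u \<in> D; \<epsilon> > 0\<rbrakk> \<Longrightarrow> \<exists>\<phi>\<in>D \<inter> Cc. form_energy1 m \<E> (\<lambda>x. u x - \<phi> x) < \<epsilon>"
    and core_dense_uniform:
      "\<lbrakk>\<psi> \<in> Cc; \<epsilon> > 0\<rbrakk> \<Longrightarrow> \<exists>\<phi>\<in>D \<inter> Cc. \<forall>x. \<bar>\<psi> x - \<phi> x\<bar> < \<epsilon>"

definition transient_form ::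
  "'a measure \<Rightarrow> ('a \<Rightarrow> real) set \<Rightarrow> (('a \<Rightarrow> real) \<Rightarrow> ('a \<Rightarrow> real) \<Rightarrow> real) \<Rightarrow> bool" where
  "transient_form m D \<E> \<longleftrightarrow>
     (\<exists>g. integrable m g \<and> (\<exists>c. \<forall>x. \<bar>g x\<bar> \<le> c) \<and> (AE x in m. g x > 0) \<and>
        (\<forall>u\<in>D. (\<integral>x. \<bar>u x\<bar> * g x \<partial>m) \<le> sqrt (\<E> u u)))"

section \<open>Extended Dirichlet space, capacity, quasi-continuity\<close>

text \<open>\<open>m\<close>-a.e. finite functions are represented by real-valued ones.\<close>

definition approximating ::
  "'a measure \<Rightarrow> ('a \<Rightarrow> real) set \<Rightarrow> (('a \<Rightarrow> real) \<Rightarrow> ('a \<Rightarrow> real) \<Rightarrow> real) \<Rightarrow>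
   (nat \<Rightarrow> 'a \<Rightarrow> real) \<Rightarrow> ('a \<Rightarrow> real) \<Rightarrow> bool" where
  "approximating m D \<E> us u \<longleftrightarrow>
     (\<forall>n. us n \<in> D) \<and> form_Cauchy (form_energy \<E>) us \<and> (AE x in m. (\<lambda>n. us n x) \<longlonglongrightarrow> u x)"

definition extended_space ::
  "'a measure \<Rightarrow> ('a \<Rightarrow> real) set \<Rightarrow> (('a \<Rightarrow> real) \<Rightarrow> ('a \<Rightarrow> real) \<Rightarrow> real) \<Rightarrow> ('a \<Rightarrow> real) set" where
  "extended_space m D \<E> = {u \<in> borel_measurable m. \<exists>us. approximating m D \<E> us u}"

text \<open>The limit does not depend on the approximating sequence.\<close>

definition extended_energy ::
  "'a measure \<Rightarrow> ('a \<Rightarrow> real) set \<Rightarrow> (('a \<Rightarrow> real) \<Rightarrow> ('a \<Rightarrow> real) \<Rightarrow> real) \<Rightarrow> ('a \<Rightarrow> real) \<Rightarrow> real" where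
  "extended_energy m D \<E> u =
     (THE c. \<exists>us. approximating m D \<E> us u \<and> (\<lambda>n. \<E> (us n) (us n)) \<longlonglongrightarrow> c)"

definition cap_open ::
  "'a measure \<Rightarrow> ('a \<Rightarrow> real) set \<Rightarrow> (('a \<Rightarrow> real) \<Rightarrow> ('a \<Rightarrow> real) \<Rightarrow> real) \<Rightarrow> 'a set \<Rightarrow> ennreal" where
  "cap_open m D \<E> U =
     (INF u\<in>{u \<in> extended_space m D \<E>. AE x in m. x \<in> U \<longrightarrow> u x \<ge> 1}.
        ennreal (extended_energy m D \<E> u))"

definition capacity ::
  "'a::topological_space measure \<Rightarrow> ('a \<Rightarrow> real) set \<Rightarrow>
   (('a \<Rightarrow> real) \<Rightarrow> ('a \<Rightarrow> real) \<Rightarrow> real) \<Rightarrow> 'a set \<Rightarrow> ennreal" where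
  "capacity m D \<E> A = (INF U\<in>{U. open U \<and> A \<subseteq> U}. cap_open m D \<E> U)"

definition quasi_continuous ::
  "'a::topological_space measure \<Rightarrow> ('a \<Rightarrow> real) set \<Rightarrow>
   (('a \<Rightarrow> real) \<Rightarrow> ('a \<Rightarrow> real) \<Rightarrow> real) \<Rightarrow> ('a \<Rightarrow> real) \<Rightarrow> bool" where
  "quasi_continuous m D \<E> v \<longleftrightarrow>
     (\<forall>\<epsilon>>0. \<exists>U. open U \<and> capacity m D \<E> U < ennreal \<epsilon> \<and> continuous_on (- U) v)"

text \<open>A quasi-continuous \<open>m\<close>-version. Two such versions differ only on a set of capacity zero, so integrals
  against diffuse measures do not depend on the choice.\<close>

definition qc_version ::
  "'a::topological_space measure \<Rightarrow> ('a \<Rightarrow> real) set \<Rightarrow>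
   (('a \<Rightarrow> real) \<Rightarrow> ('a \<Rightarrow> real) \<Rightarrow> real) \<Rightarrow> ('a \<Rightarrow> real) \<Rightarrow> 'a \<Rightarrow> real" where
  "qc_version m D \<E> u = (SOME v. quasi_continuous m D \<E> v \<and> (AE x in m. v x = u x))"

section \<open>Finite signed Borel measures\<close>

definition finite_signed_borel_measure :: "('a::topological_space set \<Rightarrow> real) \<Rightarrow> bool" where
  "finite_signed_borel_measure \<mu> \<longleftrightarrow>
     \<mu> {} = 0 \<and>
     (\<forall>A :: nat \<Rightarrow> 'a set. range A \<subseteq> sets borel \<longrightarrow> disjoint_family A \<longrightarrow>
        (\<lambda>i. \<mu> (A i)) sums \<mu> (\<Union>i. A i))"

text \<open>The Jordan decomposition: \<open>\<mu>\<^sup>+(A)\<close> is the supremum of \<open>\<mu>(B)\<close> over Borel \<open>B \<subseteq> A\<close>, and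
  \<open>\<mu>\<^sup>-\<close> is \<open>(-\<mu>)\<^sup>+\<close>. Since \<open>B = {}\<close> is allowed, the truncation by \<open>ennreal\<close> is harmless.\<close>

definition pos_variation :: "('a::topological_space set \<Rightarrow> real) \<Rightarrow> 'a measure" where
  "pos_variation \<mu> =
     measure_of UNIV (sets borel) (\<lambda>A. SUP B\<in>{B \<in> sets borel. B \<subseteq> A}. ennreal (\<mu> B))"

definition neg_variation :: "('a::topological_space set \<Rightarrow> real) \<Rightarrow> 'a measure" where
  "neg_variation \<mu> = pos_variation (\<lambda>A. - \<mu> A)"

text \<open>Quasi-continuous functions need not be Borel; they are measurable with respect to the completion
  of any finite measure charging no set of capacity zero.\<close>

definition signed_integral :: "('a::topological_space set \<Rightarrow> real) \<Rightarrow> ('a \<Rightarrow> real) \<Rightarrow> real" where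
  "signed_integral \<mu> h =
     (\<integral>x. h x \<partial>completion (pos_variation \<mu>)) - (\<integral>x. h x \<partial>completion (neg_variation \<mu>))"

text \<open>\<open>\<M>\<^sub>0\<^sub>,\<^sub>b\<close>. Borel null sets suffice, because every set of capacity zero lies in a
  \<open>G\<^sub>\<delta>\<close> set of capacity zero.\<close>

definition diffuse_measures ::
  "'a::topological_space measure \<Rightarrow> ('a \<Rightarrow> real) set \<Rightarrow>
   (('a \<Rightarrow> real) \<Rightarrow> ('a \<Rightarrow> real) \<Rightarrow> real) \<Rightarrow> ('a set \<Rightarrow> real) set" where
  "diffuse_measures m D \<E> =
     {\<mu>. finite_signed_borel_measure \<mu> \<and>
        (\<forall>N\<in>sets borel. capacity m D \<E> N = 0 \<longrightarrow>
           emeasure (pos_variation \<mu>) N + emeasure (neg_variation \<mu>) N = 0)}"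

section \<open>Resolvent and potentials\<close>

text \<open>\<open>G\<^sub>\<alpha> h\<close> is characterised up to equality \<open>m\<close>-a.e. by \<open>\<E>(G\<^sub>\<alpha> h, v) + \<alpha> (G\<^sub>\<alpha> h, v) = (h, v)\<close>
  for \<open>v \<in> D\<close>, i.e. \<open>G\<^sub>\<alpha> = (\<alpha> - L)\<^sup>-\<^sup>1\<close>.\<close>

definition resolvent ::
  "'a measure \<Rightarrow> ('a \<Rightarrow> real) set \<Rightarrow> (('a \<Rightarrow> real) \<Rightarrow> ('a \<Rightarrow> real) \<Rightarrow> real) \<Rightarrow>
   real \<Rightarrow> ('a \<Rightarrow> real) \<Rightarrow> 'a \<Rightarrow> real" where
  "resolvent m D \<E> \<alpha> h =
     (SOME u. u \<in> D \<and> (\<forall>v\<in>D. \<E> u v + \<alpha> * L2_inner m u v = L2_inner m h v))"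

text \<open>Extension to nonnegative Borel functions: the \<open>m\<close>-a.e. limit of \<open>G\<^sub>\<alpha> \<phi>\<^sub>n\<close> along any increasing
  sequence of nonnegative \<open>\<phi>\<^sub>n \<in> L\<^sup>2(E;m)\<close> with pointwise limit \<open>\<eta>\<close>.\<close>

definition resolvent_nn ::
  "'a measure \<Rightarrow> ('a \<Rightarrow> real) set \<Rightarrow> (('a \<Rightarrow> real) \<Rightarrow> ('a \<Rightarrow> real) \<Rightarrow> real) \<Rightarrow>
   real \<Rightarrow> ('a \<Rightarrow> ennreal) \<Rightarrow> 'a \<Rightarrow> ennreal" where
  "resolvent_nn m D \<E> \<alpha> \<eta> =
     (SOME h. h \<in> borel_measurable m \<and>
        (\<exists>\<phi> :: nat \<Rightarrow> 'a \<Rightarrow> real.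
           (\<forall>n. \<phi> n \<in> L2 m) \<and> (\<forall>n x. \<phi> n x \<ge> 0) \<and> incseq \<phi> \<and>
           (\<forall>x. (\<lambda>n. ennreal (\<phi> n x)) \<longlonglongrightarrow> \<eta> x) \<and>
           (AE x in m. (\<lambda>n. ennreal (resolvent m D \<E> \<alpha> (\<phi> n) x)) \<longlonglongrightarrow> h x)))"

text \<open>The supremum of a family in the lattice of \<open>m\<close>-classes. A pointwise supremum over the uncountable
  set of all \<open>\<alpha> > 0\<close> would depend on the chosen representatives.\<close>

definition is_ae_sup ::
  "'a measure \<Rightarrow> ('a \<Rightarrow> ennreal) set \<Rightarrow> ('a \<Rightarrow> ennreal) \<Rightarrow> bool" where
  "is_ae_sup m F h \<longleftrightarrow>
     h \<in> borel_measurable m \<and> (\<forall>g\<in>F. AE x in m. g x \<le> h x) \<and>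
     (\<forall>k\<in>borel_measurable m. (\<forall>g\<in>F. AE x in m. g x \<le> k x) \<longrightarrow> (AE x in m. h x \<le> k x))"

definition potential_nn ::
  "'a measure \<Rightarrow> ('a \<Rightarrow> real) set \<Rightarrow> (('a \<Rightarrow> real) \<Rightarrow> ('a \<Rightarrow> real) \<Rightarrow> real) \<Rightarrow>
   ('a \<Rightarrow> ennreal) \<Rightarrow> 'a \<Rightarrow> ennreal" where
  "potential_nn m D \<E> \<eta> = (SOME h. is_ae_sup m ((\<lambda>\<alpha>. resolvent_nn m D \<E> \<alpha> \<eta>) ` {0<..}) h)"

text \<open>\<open>G\<eta> = G\<eta>\<^sup>+ - G\<eta>\<^sup>-\<close>, meaningful when \<open>G\<bar>\<eta>\<bar> < \<infinity>\<close> \<open>m\<close>-a.e.; \<open>ennreal\<close> truncates at zero, so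
  \<open>ennreal (\<eta> x)\<close> is \<open>\<eta>\<^sup>+(x)\<close>.\<close>

definition potential ::
  "'a measure \<Rightarrow> ('a \<Rightarrow> real) set \<Rightarrow> (('a \<Rightarrow> real) \<Rightarrow> ('a \<Rightarrow> real) \<Rightarrow> real) \<Rightarrow>
   ('a \<Rightarrow> real) \<Rightarrow> 'a \<Rightarrow> real" where
  "potential m D \<E> \<eta> x =
     enn2real (potential_nn m D \<E> (\<lambda>y. ennreal (\<eta> y)) x) -
     enn2real (potential_nn m D \<E> (\<lambda>y. ennreal (- \<eta> y)) x)"

section \<open>Solutions in the sense of duality\<close>

definition caratheodory :: "('a::topological_space \<Rightarrow> real \<Rightarrow> real) \<Rightarrow> bool" where
  "caratheodory f \<longleftrightarrow>
     (\<forall>y. (\<lambda>x. f x y) \<in> borel_measurable borel) \<and> (\<forall>x. continuous_on UNIV (f x))"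

text \<open>\<open>u\<close> solves \<open>-Lu = f(\<cdot>,u) + \<mu>\<close>, where \<open>L\<close> is the generator of \<open>\<E>\<close>; the notion refers to \<open>L\<close> only
  through \<open>G\<close>. Integrability of \<open>u \<eta>\<close> has to be demanded explicitly, as the Bochner integral of a
  non-integrable function is \<open>0\<close>; both integrals on the right-hand side exist automatically.\<close>

definition duality_solution ::
  "'a::topological_space measure \<Rightarrow> ('a \<Rightarrow> real) set \<Rightarrow>
   (('a \<Rightarrow> real) \<Rightarrow> ('a \<Rightarrow> real) \<Rightarrow> real) \<Rightarrow>
   ('a \<Rightarrow> real \<Rightarrow> real) \<Rightarrow> ('a set \<Rightarrow> real) \<Rightarrow> ('a \<Rightarrow> real) \<Rightarrow> bool" where
  "duality_solution m D \<E> f \<mu> u \<longleftrightarrow>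
     u \<in> borel_measurable m \<and>
     integrable m (\<lambda>x. f x (u x)) \<and>
     (\<forall>\<eta>. integrable m \<eta> \<longrightarrow>
        (\<exists>c::real. AE x in m. potential_nn m D \<E> (\<lambda>y. ennreal \<bar>\<eta> y\<bar>) x \<le> ennreal c) \<longrightarrow>
        integrable m (\<lambda>x. u x * \<eta> x) \<and>
        (\<integral>x. u x * \<eta> x \<partial>m) =
          (\<integral>x. f x (u x) * potential m D \<E> \<eta> x \<partial>m) +
          signed_integral \<mu> (qc_version m D \<E> (potential m D \<E> \<eta>)))"

end

theory Submission
  imports Defs
begin

text \<open>Let \<open>w = u\<^sub>1 - u\<^sub>2\<close> and \<open>F = f(\<cdot>,u\<^sub>1) - f(\<cdot>,u\<^sub>2)\<close>. Both solutions see the same term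
  \<open>\<integral> G\<eta> d\<mu>\<close>, so it cancels: \<open>\<integral> w \<eta> dm = \<integral> F G\<eta> dm\<close> for all admissible \<open>\<eta>\<close>, that is, \<open>w\<close> is the
  potential of \<open>F \<in> L\<^sup>1\<close> in the sense of duality, while monotonicity of \<open>f\<close> gives \<open>F w \<le> 0\<close>. It remains to
  show that such a \<open>w\<close> is \<open>\<le> 0\<close>; exchanging the solutions then gives \<open>w = 0\<close>.

  Were \<open>w\<close> in the form domain, one could test \<open>\<E>(w,v) = (F,v)\<close> with \<open>v = \<psi>(w)\<close>, where \<open>\<psi>\<close> clamps to
  \<open>[0,1]\<close>. The Markov property yields \<open>\<E>(\<psi>(w),\<psi>(w)) \<le> \<E>(w,\<psi>(w)) = (F,\<psi>(w)) \<le> 0\<close>, and transience turns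
  this into \<open>\<integral> \<psi>(w) g dm = 0\<close> for a strictly positive \<open>g\<close>, hence \<open>w \<le> 0\<close>. A priori \<open>w\<close> is merely
  measurable, so the argument is run on approximations.

  Transience gives \<open>(g, G\<^sub>\<alpha> g) \<le> 1\<close> uniformly in \<open>\<alpha>\<close>, so \<open>Gg < \<infinity>\<close> a.e. and the sets
  \<open>B\<^sub>k = {Gg \<le> k+1}\<close> exhaust the space up to a null set. By the maximum principle \<open>G(g 1\<^bsub>B\<^sub>k\<^esub>) \<le> k+1\<close>
  a.e. (\<open>resolvent_truncated_reference_le\<close>), so every function bounded by a multiple of some \<open>g 1\<^bsub>B\<^sub>k\<^esub>\<close> is
  an admissible test function. Truncating \<open>F\<close> to be of this kind gives \<open>F\<^sub>j \<rightarrow> F\<close> in \<open>L\<^sup>1\<close>, and symmetry of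
  \<open>G\<close> gives \<open>\<integral> |GF\<^sub>j - w| g 1\<^bsub>B\<^sub>k\<^esub> dm \<le> (k+1) \<parallel>F\<^sub>j - F\<parallel>\<^sub>1\<close>. Along a subsequence
  \<open>GF\<^sub>j \<rightarrow> w\<close> a.e. (\<open>dual_potential_approximation\<close>). For each \<open>F\<^sub>j\<close> the estimate
  \<open>(\<integral> \<psi>(GF\<^sub>j) g dm)\<^sup>2 \<le> \<integral> F\<^sub>j \<psi>(GF\<^sub>j) dm\<close> holds (\<open>potential_clamp_inequality\<close>, proved for \<open>G\<^sub>\<alpha> F\<^sub>j\<close>,
  which does lie in the domain, with \<open>\<alpha> \<rightarrow> 0\<close>), and dominated convergence carries it to \<open>w\<close>
  (\<open>dual_potential_nonpos\<close>).

  The resolvent and the potential are given by choice operators, so existence and uniqueness have to be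
  established first: \<open>G\<^sub>\<alpha> h\<close> is the minimiser of \<open>\<E>\<^sub>\<alpha>(v,v) - 2(h,v)\<close>.\<close>

section \<open>Square-integrable functions\<close>

lemma L2_mult_integrable:
  assumes "u \<in> L2 m" "v \<in> L2 m"
  shows "integrable m (\<lambda>x. u x * v x)"
proof (rule Bochner_Integration.integrable_bound)
  show "integrable m (\<lambda>x. (u x)\<^sup>2 + (v x)\<^sup>2)"
    using assms by (auto simp: L2_def)
  show "(\<lambda>x. u x * v x) \<in> borel_measurable m"
    using assms by (auto simp: L2_def)
  have "\<bar>a * b\<bar> \<le> a\<^sup>2 + b\<^sup>2" for a b :: real
  proof -
    have "0 \<le> (\<bar>a\<bar> - \<bar>b\<bar>)\<^sup>2" by simp
    then have "2 * (\<bar>a\<bar> * \<bar>b\<bar>) \<le> a\<^sup>2 + b\<^sup>2"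
      by (simp add: power2_diff)
    moreover have "0 \<le> \<bar>a\<bar> * \<bar>b\<bar>" by simp
    ultimately show ?thesis
      unfolding abs_mult by linarith
  qed
  then show "AE x in m. norm (u x * v x) \<le> norm ((u x)\<^sup>2 + (v x)\<^sup>2)"
    by auto
qed

lemma L2_add:
  assumes "u \<in> L2 m" "v \<in> L2 m"
  shows "(\<lambda>x. u x + v x) \<in> L2 m"
proof -
  have "integrable m (\<lambda>x. (u x)\<^sup>2 + (v x)\<^sup>2 + 2 * (u x * v x))"
    using assms L2_mult_integrable[OF assms] by (auto simp: L2_def)
  then show ?thesis
    using assms by (auto simp: L2_def power2_sum mult.assoc)
qed

lemma L2_scale: "u \<in> L2 m \<Longrightarrow> (\<lambda>x. c * u x) \<in> L2 m"
  by (auto simp: L2_def power_mult_distrib)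

lemma L2_diff:
  assumes "u \<in> L2 m" "v \<in> L2 m"
  shows "(\<lambda>x. u x - v x) \<in> L2 m"
  using L2_add[OF assms(1) L2_scale[OF assms(2), of "-1"]] by simp

lemma bounded_integrable_L2:
  fixes \<eta> :: "'a \<Rightarrow> real"
  assumes "integrable m \<eta>" "\<And>x. \<bar>\<eta> x\<bar> \<le> c"
  shows "\<eta> \<in> L2 m"
proof -
  have "integrable m (\<lambda>x. (\<eta> x)\<^sup>2)"
  proof (rule Bochner_Integration.integrable_bound)
    show "integrable m (\<lambda>x. c * \<bar>\<eta> x\<bar>)" using assms by auto
    have "\<bar>\<eta> x\<bar> * \<bar>\<eta> x\<bar> \<le> c * \<bar>\<eta> x\<bar>" for x
      using assms(2)[of x] by (intro mult_right_mono) auto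
    moreover have "c \<ge> 0" using assms(2)[of undefined] by linarith
    ultimately show "AE x in m. norm ((\<eta> x)\<^sup>2) \<le> norm (c * \<bar>\<eta> x\<bar>)"
      by (auto simp: power2_eq_square abs_mult)
  qed (use assms in auto)
  then show ?thesis using assms by (auto simp: L2_def)
qed

lemma L2_inner_sym: "L2_inner m u v = L2_inner m v u"
  by (simp add: L2_inner_def mult.commute)

lemma L2_inner_add:
  assumes "u \<in> L2 m" "u' \<in> L2 m" "v \<in> L2 m"
  shows "L2_inner m (\<lambda>x. u x + u' x) v = L2_inner m u v + L2_inner m u' v"
  using assms by (simp add: L2_inner_def distrib_right L2_mult_integrable)

lemma L2_inner_scale: "L2_inner m (\<lambda>x. c * u x) v = c * L2_inner m u v"
  by (simp add: L2_inner_def mult.assoc)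

lemma L2_inner_nonneg: "L2_inner m u u \<ge> 0"
  by (simp add: L2_inner_def)

lemma L2_inner_mono:
  assumes "u \<in> L2 m" "v \<in> L2 m" "u' \<in> L2 m" "v' \<in> L2 m"
    and "AE x in m. u x * v x \<le> u' x * v' x"
  shows "L2_inner m u v \<le> L2_inner m u' v'"
  unfolding L2_inner_def
  by (rule integral_mono_AE) (use assms L2_mult_integrable in auto)

lemma L2_inner_eq_0_imp_AE:
  assumes "u \<in> L2 m" "L2_inner m u u \<le> 0"
  shows "AE x in m. u x = 0"
proof -
  have "(\<integral>x. u x * u x \<partial>m) = 0"
    using assms(2) L2_inner_nonneg[of m u] unfolding L2_inner_def by linarith
  then have "AE x in m. u x * u x = 0"
    using integral_nonneg_eq_0_iff_AE[OF L2_mult_integrable[OF assms(1,1)]] by auto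
  then show ?thesis by auto
qed

text \<open>Young's inequality bounds \<open>\<E>\<^sub>\<alpha>(v,v) - 2(h,v)\<close> from below and makes \<open>\<alpha> G\<^sub>\<alpha>\<close> a contraction of
  \<open>L\<^sup>2\<close>.\<close>

lemma L2_inner_Young:
  assumes h: "h \<in> L2 m" and u: "u \<in> L2 m" and \<alpha>: "\<alpha> > 0"
  shows "2 * L2_inner m h u \<le> \<alpha> * L2_inner m u u + L2_inner m h h / \<alpha>"
proof -
  note I = L2_mult_integrable[OF h u] L2_mult_integrable[OF u u] L2_mult_integrable[OF h h]
  have "2 * (h x * u x) \<le> \<alpha> * (u x * u x) + (h x * h x) / \<alpha>" for x
  proof -
    have "0 \<le> (\<alpha> * u x - h x)\<^sup>2 / \<alpha>" using \<alpha> by simp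
    also have "\<dots> = \<alpha> * (u x * u x) + (h x * h x) / \<alpha> - 2 * (h x * u x)"
      using \<alpha> by (simp add: power2_eq_square field_simps)
    finally show ?thesis by simp
  qed
  then have "(\<integral>x. 2 * (h x * u x) \<partial>m) \<le> (\<integral>x. \<alpha> * (u x * u x) + (h x * h x) / \<alpha> \<partial>m)"
    using I by (intro integral_mono) auto
  then show ?thesis using I by (simp add: L2_inner_def)
qed

text \<open>The discriminant of a nonnegative quadratic polynomial is not positive; \<open>c = 0\<close> is the degenerate
  case in which the polynomial is affine.\<close>

lemma square_le_of_quadratic_nonneg:
  fixes a b c :: real
  assumes "\<And>t. 0 \<le> a + 2 * t * b + t\<^sup>2 * c" "c \<ge> 0"
  shows "b\<^sup>2 \<le> a * c"
proof (cases "c = 0")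
  case True
  have "b = 0"
  proof (rule ccontr)
    assume "b \<noteq> 0"
    then show False using assms(1)[of "- (a + 1) / (2 * b)"] True by (simp add: field_simps)
  qed
  then show ?thesis using True by simp
next
  case False
  then have c: "c > 0" using assms(2) by simp
  have "0 \<le> a - b\<^sup>2 / c"
    using assms(1)[of "- b / c"] c by (simp add: power2_eq_square field_simps)
  then show ?thesis using c by (simp add: field_simps)
qed

section \<open>The resolvent\<close>

text \<open>The unit contraction of the Markov property.\<close>

definition unit_clamp :: "real \<Rightarrow> real" where
  "unit_clamp t = min (max t 0) 1"

lemma unit_clamp_bounds: "0 \<le> unit_clamp t" "unit_clamp t \<le> 1" "\<bar>unit_clamp t\<bar> \<le> 1"
  by (auto simp: unit_clamp_def)

lemma borel_measurable_unit_clamp [measurable]: "unit_clamp \<in> borel_measurable borel"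
  unfolding unit_clamp_def by measurable

text \<open>Moving from the clamped value towards or beyond the original one stays in the same fibre of the
  clamp. This allows variations of the contraction inequality in the direction \<open>u - \<psi>(u)\<close>.\<close>

lemma unit_clamp_extrapolate:
  assumes "s \<ge> 0"
  shows "unit_clamp (unit_clamp t + s * (t - unit_clamp t)) = unit_clamp t"
proof -
  consider "t < 0" | "0 \<le> t" "t \<le> 1" | "1 < t" by linarith
  then show ?thesis
  proof cases
    case 1
    then show ?thesis using assms mult_nonneg_nonpos[of s t] by (simp add: unit_clamp_def)
  next
    case 2
    then show ?thesis by (simp add: unit_clamp_def)
  next
    case 3
    then show ?thesis using assms mult_nonneg_nonneg[of s "t - 1"] by (simp add: unit_clamp_def)
  qed
qed

context symmetric_dirichlet_form
begin

lemma dom_imp_L2: "u \<in> D \<Longrightarrow> u \<in> L2 m"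
  using dom_L2 by auto

lemma dom_measurable: "u \<in> D \<Longrightarrow> u \<in> borel_measurable m"
  using dom_L2 by (auto simp: L2_def)

lemma dom_diff:
  assumes "u \<in> D" "v \<in> D" shows "(\<lambda>x. u x - v x) \<in> D"
  using dom_add[OF assms(1) dom_scale[OF assms(2), of "-1"]] by simp

text \<open>The form \<open>\<E>\<^sub>\<alpha> = \<E> + \<alpha> (\<cdot>,\<cdot>)\<close>.\<close>

definition form_shift :: "real \<Rightarrow> ('a \<Rightarrow> real) \<Rightarrow> ('a \<Rightarrow> real) \<Rightarrow> real" where
  "form_shift \<alpha> u v = \<E> u v + \<alpha> * L2_inner m u v"

lemma form_shift_sym: "u \<in> D \<Longrightarrow> v \<in> D \<Longrightarrow> form_shift \<alpha> u v = form_shift \<alpha> v u"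
  by (simp add: form_shift_def form_sym L2_inner_sym)

lemma form_shift_add:
  "u \<in> D \<Longrightarrow> u' \<in> D \<Longrightarrow> v \<in> D \<Longrightarrow>
    form_shift \<alpha> (\<lambda>x. u x + u' x) v = form_shift \<alpha> u v + form_shift \<alpha> u' v"
  by (simp add: form_shift_def form_add L2_inner_add dom_imp_L2 algebra_simps)

lemma form_shift_scale:
  "u \<in> D \<Longrightarrow> v \<in> D \<Longrightarrow> form_shift \<alpha> (\<lambda>x. c * u x) v = c * form_shift \<alpha> u v"
  by (simp add: form_shift_def form_scale L2_inner_scale algebra_simps)

lemma form_shift_lincomb:
  assumes "u \<in> D" "u' \<in> D" "v \<in> D"
  shows "form_shift \<alpha> (\<lambda>x. u x + c * u' x) v = form_shift \<alpha> u v + c * form_shift \<alpha> u' v"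
  using form_shift_add[OF assms(1) dom_scale[OF assms(2)] assms(3)] form_shift_scale[OF assms(2,3)]
  by simp

lemma form_shift_nonneg: "u \<in> D \<Longrightarrow> \<alpha> \<ge> 0 \<Longrightarrow> form_shift \<alpha> u u \<ge> 0"
  by (simp add: form_shift_def form_nonneg L2_inner_nonneg)

lemma form_shift_square:
  assumes "u \<in> D" "v \<in> D"
  shows "form_shift \<alpha> (\<lambda>x. u x + t * v x) (\<lambda>x. u x + t * v x) =
    form_shift \<alpha> u u + 2 * t * form_shift \<alpha> u v + t\<^sup>2 * form_shift \<alpha> v v"
proof -
  let ?s = "\<lambda>x. u x + t * v x"
  have s: "?s \<in> D" by (intro dom_add dom_scale assms)
  have "form_shift \<alpha> ?s ?s = form_shift \<alpha> u ?s + t * form_shift \<alpha> v ?s"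
    using assms s by (rule form_shift_lincomb)
  also have "form_shift \<alpha> u ?s = form_shift \<alpha> u u + t * form_shift \<alpha> u v"
    using assms s form_shift_lincomb[of u v u \<alpha> t] form_shift_sym by metis
  also have "form_shift \<alpha> v ?s = form_shift \<alpha> u v + t * form_shift \<alpha> v v"
    using assms s form_shift_lincomb[of u v v \<alpha> t] form_shift_sym by metis
  finally show ?thesis by (simp add: algebra_simps power2_eq_square)
qed

lemma form_shift_Cauchy_Schwarz:
  assumes "u \<in> D" "v \<in> D" "\<alpha> \<ge> 0"
  shows "(form_shift \<alpha> u v)\<^sup>2 \<le> form_shift \<alpha> u u * form_shift \<alpha> v v"
proof (rule square_le_of_quadratic_nonneg)
  show "0 \<le> form_shift \<alpha> u u + 2 * t * form_shift \<alpha> u v + t\<^sup>2 * form_shift \<alpha> v v" for t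
    using form_shift_nonneg[of "\<lambda>x. u x + t * v x" \<alpha>] dom_add[OF assms(1) dom_scale[OF assms(2)]]
      form_shift_square[OF assms(1,2)] assms(3) by simp
qed (use assms form_shift_nonneg in auto)

lemma form_energy1_le_shift:
  assumes "u \<in> D" "\<alpha> > 0"
  shows "form_energy1 m \<E> u \<le> (1 + 1 / \<alpha>) * form_shift \<alpha> u u"
  using assms form_nonneg[of u] L2_inner_nonneg[of m u]
  by (simp add: form_energy1_def form_shift_def field_simps)

lemma form_shift_le_energy1:
  assumes "u \<in> D" "\<alpha> > 0"
  shows "form_shift \<alpha> u u \<le> (1 + \<alpha>) * form_energy1 m \<E> u"
  using assms form_nonneg[of u] L2_inner_nonneg[of m u]
  by (simp add: form_energy1_def form_shift_def field_simps)

definition is_resolvent :: "real \<Rightarrow> ('a \<Rightarrow> real) \<Rightarrow> ('a \<Rightarrow> real) \<Rightarrow> bool" where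
  "is_resolvent \<alpha> h u \<longleftrightarrow> u \<in> D \<and> (\<forall>v\<in>D. form_shift \<alpha> u v = L2_inner m h v)"

text \<open>The Riesz representation theorem, proved directly because the domain consists of functions rather
  than classes: a minimising sequence of \<open>J\<close> is Cauchy by the parallelogram identity, and the
  Euler--Lagrange equation holds approximately along it, hence exactly for its limit.\<close>

lemma is_resolvent_exists:
  assumes h: "h \<in> L2 m" and \<alpha>: "\<alpha> > 0"
  shows "\<exists>u. is_resolvent \<alpha> h u"
proof -
  define J where "J v = form_shift \<alpha> v v - 2 * L2_inner m h v" for v
  define d where "d = Inf (J ` D)"
  have J_lower: "- (L2_inner m h h / \<alpha>) \<le> J v" if v: "v \<in> D" for v
    using L2_inner_Young[OF h dom_imp_L2[OF v] \<alpha>] form_nonneg[OF v]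
    by (simp add: J_def form_shift_def)
  have bdd: "bdd_below (J ` D)" using J_lower by (intro bdd_belowI2)
  have d_le: "d \<le> J v" if "v \<in> D" for v
    unfolding d_def using bdd that by (intro cInf_lower) auto
  have "\<exists>v\<in>D. J v < d + 1 / real (Suc n)" for n
    using cInf_lessD[of "J ` D" "d + 1 / real (Suc n)"] dom_zero by (auto simp: d_def)
  then obtain us where us: "\<And>n. us n \<in> D" "\<And>n. J (us n) < d + 1 / real (Suc n)" by metis
  have J_lin: "J (\<lambda>x. u x + t * v x) =
      J u + 2 * t * (form_shift \<alpha> u v - L2_inner m h v) + t\<^sup>2 * form_shift \<alpha> v v"
    if "u \<in> D" "v \<in> D" for u v t
  proof -
    have "L2_inner m h (\<lambda>x. u x + t * v x) = L2_inner m (\<lambda>x. u x + t * v x) h"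
      by (rule L2_inner_sym)
    also have "\<dots> = L2_inner m u h + t * L2_inner m v h"
      using that h by (subst L2_inner_add) (auto intro!: dom_imp_L2 dom_scale simp: L2_inner_scale)
    finally have "L2_inner m h (\<lambda>x. u x + t * v x) = L2_inner m h u + t * L2_inner m h v"
      by (simp add: L2_inner_sym[of m h])
    then show ?thesis
      unfolding J_def form_shift_square[OF that] by (simp add: algebra_simps)
  qed
  \<comment> \<open>The midpoint of two near-minimisers cannot lie below the infimum, so they are close.\<close>
  have near: "form_shift \<alpha> (\<lambda>x. us i x - us j x) (\<lambda>x. us i x - us j x)
      \<le> 2 * (1 / real (Suc i) + 1 / real (Suc j))" for i j
  proof -
    let ?e = "\<lambda>x. us i x - us j x"
    have e: "?e \<in> D" by (intro dom_diff us)
    have "J (us i) = J (\<lambda>x. us j x + 1 * ?e x)" by simp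
    also have "\<dots> = J (us j) + 2 * (form_shift \<alpha> (us j) ?e - L2_inner m h ?e) + form_shift \<alpha> ?e ?e"
      using J_lin[OF us(1)[of j] e, of 1] by simp
    finally have 1: "J (us i) = \<dots>" .
    have "d \<le> J (\<lambda>x. us j x + (1/2) * ?e x)"
      by (intro d_le dom_add[OF us(1) dom_scale] e)
    also have "\<dots> = J (us j) + (form_shift \<alpha> (us j) ?e - L2_inner m h ?e) + form_shift \<alpha> ?e ?e / 4"
      using J_lin[OF us(1)[of j] e, of "1/2"] by (simp add: power2_eq_square)
    finally show ?thesis using 1 us(2)[of i] us(2)[of j] by simp
  qed
  have "form_Cauchy (form_energy1 m \<E>) us"
    unfolding form_Cauchy_def
  proof (intro allI impI)
    fix \<epsilon> :: real assume \<epsilon>: "\<epsilon> > 0"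
    define K where "K = 1 + 1 / \<alpha>"
    have K: "K > 0" using \<alpha> by (simp add: K_def add_pos_pos)
    obtain N where N: "1 / real (Suc N) < \<epsilon> / (4 * K)"
      using reals_Archimedean[of "\<epsilon> / (4 * K)"] \<epsilon> K by (auto simp: inverse_eq_divide)
    show "\<exists>N. \<forall>i\<ge>N. \<forall>j\<ge>N. form_energy1 m \<E> (\<lambda>x. us i x - us j x) < \<epsilon>"
    proof (intro exI allI impI)
      fix i j assume ij: "i \<ge> N" "j \<ge> N"
      have "1 / real (Suc i) \<le> 1 / real (Suc N)" "1 / real (Suc j) \<le> 1 / real (Suc N)"
        using ij by (auto intro!: divide_left_mono)
      moreover have "4 * (\<epsilon> / (4 * K)) = \<epsilon> / K" by simp
      ultimately have "2 * (1 / real (Suc i) + 1 / real (Suc j)) < \<epsilon> / K"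
        using N by argo
      then have "form_shift \<alpha> (\<lambda>x. us i x - us j x) (\<lambda>x. us i x - us j x) < \<epsilon> / K"
        using near[of i j] by linarith
      then have "K * form_shift \<alpha> (\<lambda>x. us i x - us j x) (\<lambda>x. us i x - us j x) < \<epsilon>"
        using K by (simp add: field_simps)
      moreover have "form_energy1 m \<E> (\<lambda>x. us i x - us j x) \<le>
          K * form_shift \<alpha> (\<lambda>x. us i x - us j x) (\<lambda>x. us i x - us j x)"
        unfolding K_def using us(1) \<alpha> by (intro form_energy1_le_shift dom_diff)
      ultimately show "form_energy1 m \<E> (\<lambda>x. us i x - us j x) < \<epsilon>" by linarith
    qed
  qed
  then obtain u where u: "u \<in> D" "(\<lambda>n. form_energy1 m \<E> (\<lambda>x. us n x - u x)) \<longlonglongrightarrow> 0"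
    using form_closed us(1) by blast
  have "form_shift \<alpha> u v = L2_inner m h v" if v: "v \<in> D" for v
  proof -
    define C where "C = form_shift \<alpha> v v"
    define A where "A n = form_shift \<alpha> (us n) v - L2_inner m h v" for n
    define e where "e n = (\<lambda>x. us n x - u x)" for n
    have C: "C \<ge> 0" using v \<alpha> by (simp add: C_def form_shift_nonneg)
    have e: "e n \<in> D" for n unfolding e_def by (intro dom_diff us u)
    have "(A n)\<^sup>2 \<le> inverse (real (Suc n)) * C" for n
    proof (rule square_le_of_quadratic_nonneg[OF _ C])
      fix t
      have "d \<le> J (\<lambda>x. us n x + t * v x)" by (intro d_le dom_add[OF us(1) dom_scale] v)
      then show "0 \<le> inverse (real (Suc n)) + 2 * t * A n + t\<^sup>2 * C"
        using J_lin[OF us(1)[of n] v, of t] us(2)[of n] by (simp add: A_def C_def inverse_eq_divide)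
    qed
    then have "(\<lambda>n. (A n)\<^sup>2) \<longlonglongrightarrow> 0"
      by (intro tendsto_sandwich[OF _ _ tendsto_const
            tendsto_mult_left_zero[OF LIMSEQ_inverse_real_of_nat, of C]] always_eventually allI) simp_all
    then have A: "A \<longlonglongrightarrow> 0" by simp
    \<comment> \<open>The defect \<open>A n\<close> vanishes in the limit; it also tends to the defect of \<open>u\<close>.\<close>
    have bound: "(form_shift \<alpha> (e n) v)\<^sup>2 \<le> (1 + \<alpha>) * form_energy1 m \<E> (e n) * C" for n
      using form_shift_Cauchy_Schwarz[OF e v, of \<alpha> n] \<alpha>
        mult_right_mono[OF form_shift_le_energy1[OF e[of n] \<alpha>] C]
      by (simp add: C_def)
    have lim: "(\<lambda>n. (1 + \<alpha>) * form_energy1 m \<E> (e n) * C) \<longlonglongrightarrow> 0"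
      using u(2) unfolding e_def by (intro tendsto_mult_left_zero tendsto_mult_right_zero)
    have "(\<lambda>n. (form_shift \<alpha> (e n) v)\<^sup>2) \<longlonglongrightarrow> 0"
      by (rule tendsto_sandwich[OF _ _ tendsto_const lim]) (simp_all add: bound)
    then have B: "(\<lambda>n. form_shift \<alpha> (e n) v) \<longlonglongrightarrow> 0" by simp
    have "form_shift \<alpha> (us n) v = form_shift \<alpha> u v + form_shift \<alpha> (e n) v" for n
      using form_shift_add[OF u(1) e[of n] v] by (simp add: e_def)
    then have "A n - form_shift \<alpha> (e n) v = form_shift \<alpha> u v - L2_inner m h v" for n
      by (simp add: A_def)
    then have "(\<lambda>n. form_shift \<alpha> u v - L2_inner m h v) \<longlonglongrightarrow> 0 - 0"
      using tendsto_diff[OF A B] by simp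
    then show ?thesis by (simp add: LIMSEQ_const_iff)
  qed
  then show ?thesis using u(1) by (auto simp: is_resolvent_def)
qed

abbreviation "G \<equiv> resolvent m D \<E>"

lemma resolvent:
  assumes "h \<in> L2 m" "\<alpha> > 0"
  shows "is_resolvent \<alpha> h (G \<alpha> h)"
  using someI_ex[OF is_resolvent_exists[OF assms]]
  unfolding resolvent_def is_resolvent_def form_shift_def by auto

lemma resolvent_dom: "h \<in> L2 m \<Longrightarrow> \<alpha> > 0 \<Longrightarrow> G \<alpha> h \<in> D"
  using resolvent by (auto simp: is_resolvent_def)

lemma is_resolvent_unique:
  assumes "is_resolvent \<alpha> h u" "is_resolvent \<alpha> h u'" "\<alpha> > 0"
  shows "AE x in m. u x = u' x"
proof -
  let ?d = "\<lambda>x. u x + (-1) * u' x"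
  have dom: "u \<in> D" "u' \<in> D" using assms by (auto simp: is_resolvent_def)
  have d: "?d \<in> D" using dom by (intro dom_add dom_scale)
  have "form_shift \<alpha> ?d ?d = 0"
    using form_shift_lincomb[OF dom d, of \<alpha> "-1"] assms d by (simp add: is_resolvent_def)
  then have "\<alpha> * L2_inner m ?d ?d \<le> 0"
    using form_nonneg[OF d] by (simp add: form_shift_def)
  then have "L2_inner m ?d ?d \<le> 0"
    using assms(3) by (simp add: mult_le_0_iff)
  from L2_inner_eq_0_imp_AE[OF dom_imp_L2[OF d] this] show ?thesis by simp
qed

lemma is_resolvent_lincomb:
  assumes "is_resolvent \<alpha> h u" "is_resolvent \<alpha> h' u'" "h \<in> L2 m" "h' \<in> L2 m"
  shows "is_resolvent \<alpha> (\<lambda>x. h x + c * h' x) (\<lambda>x. u x + c * u' x)"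
  using assms
  by (auto simp: is_resolvent_def form_shift_lincomb L2_inner_add L2_scale L2_inner_scale dom_imp_L2
      intro!: dom_add dom_scale)

lemma is_resolvent_scale:
  assumes "is_resolvent \<alpha> h u" "h \<in> L2 m"
  shows "is_resolvent \<alpha> (\<lambda>x. c * h x) (\<lambda>x. c * u x)"
  using assms
  by (auto simp: is_resolvent_def form_shift_scale L2_inner_scale dom_scale)

lemma resolvent_lincomb:
  assumes "h \<in> L2 m" "h' \<in> L2 m" "\<alpha> > 0"
  shows "AE x in m. G \<alpha> (\<lambda>x. h x + c * h' x) x = G \<alpha> h x + c * G \<alpha> h' x"
  using assms
  by (intro is_resolvent_unique[OF resolvent is_resolvent_lincomb] resolvent L2_add L2_scale)

lemma resolvent_scale:
  assumes "h \<in> L2 m" "\<alpha> > 0"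
  shows "AE x in m. G \<alpha> (\<lambda>x. c * h x) x = c * G \<alpha> h x"
  using assms by (intro is_resolvent_unique[OF resolvent is_resolvent_scale] resolvent L2_scale)

lemma resolvent_symmetric:
  assumes "h \<in> L2 m" "k \<in> L2 m" "\<alpha> > 0"
  shows "L2_inner m (G \<alpha> h) k = L2_inner m h (G \<alpha> k)"
proof -
  have "L2_inner m h (G \<alpha> k) = form_shift \<alpha> (G \<alpha> h) (G \<alpha> k)"
    using assms resolvent[of h \<alpha>] resolvent_dom by (simp add: is_resolvent_def)
  also have "\<dots> = form_shift \<alpha> (G \<alpha> k) (G \<alpha> h)"
    using assms by (intro form_shift_sym resolvent_dom)
  also have "\<dots> = L2_inner m k (G \<alpha> h)"
    using assms resolvent[of k \<alpha>] resolvent_dom by (simp add: is_resolvent_def)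
  finally show ?thesis by (simp add: L2_inner_sym)
qed

lemma is_resolvent_L2_bound:
  assumes "is_resolvent \<alpha> h u" "h \<in> L2 m" "\<alpha> > 0"
  shows "\<alpha>\<^sup>2 * L2_inner m u u \<le> L2_inner m h h"
proof -
  have u: "u \<in> D" "u \<in> L2 m" using assms dom_imp_L2 by (auto simp: is_resolvent_def)
  have "\<alpha> * L2_inner m u u \<le> form_shift \<alpha> u u"
    using form_nonneg[OF u(1)] by (simp add: form_shift_def)
  also have "\<dots> = L2_inner m h u" using assms u by (simp add: is_resolvent_def)
  also have "\<dots> \<le> (\<alpha> * L2_inner m u u + L2_inner m h h / \<alpha>) / 2"
    using L2_inner_Young[OF assms(2) u(2) assms(3)] by simp
  finally show ?thesis using assms(3) by (simp add: field_simps power2_eq_square)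
qed

subsection \<open>Consequences of the Markov property\<close>

lemma unit_clamp_dom: "u \<in> D \<Longrightarrow> (\<lambda>x. unit_clamp (u x)) \<in> D"
  using form_markov by (simp add: unit_clamp_def)

text \<open>With \<open>p = \<psi>(u)\<close> and \<open>q = u - p\<close>, all \<open>p + t q\<close> for \<open>t \<ge> 0\<close> have the same clamp \<open>p\<close>, so
  \<open>t \<mapsto> \<E>(p + t q, p + t q)\<close> is minimal at \<open>t = 0\<close>; its right derivative there is \<open>2 \<E>(p,q)\<close>.\<close>

lemma form_unit_clamp_remainder_nonneg:
  assumes u: "u \<in> D"
  shows "\<E> (\<lambda>x. unit_clamp (u x)) (\<lambda>x. u x - unit_clamp (u x)) \<ge> 0"
proof (rule ccontr)
  define p where "p = (\<lambda>x. unit_clamp (u x))"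
  define q where "q = (\<lambda>x. u x - p x)"
  have p: "p \<in> D" unfolding p_def using u by (rule unit_clamp_dom)
  have q: "q \<in> D" unfolding q_def using u p by (rule dom_diff)
  have ineq: "0 \<le> 2 * t * \<E> p q + t\<^sup>2 * \<E> q q" if "t \<ge> 0" for t
  proof -
    have "(\<lambda>x. unit_clamp (p x + t * q x)) = p"
      using unit_clamp_extrapolate[OF that] by (simp add: p_def q_def)
    then have "\<E> p p \<le> \<E> (\<lambda>x. p x + t * q x) (\<lambda>x. p x + t * q x)"
      using form_markov[of "\<lambda>x. p x + t * q x"] dom_add[OF p dom_scale[OF q]]
      by (simp add: unit_clamp_def)
    also have "\<dots> = \<E> p p + 2 * t * \<E> p q + t\<^sup>2 * \<E> q q"
      using form_shift_square[OF p q, of 0 t] by (simp add: form_shift_def)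
    finally show ?thesis by simp
  qed
  assume "\<not> ?thesis"
  then have b: "\<E> p q < 0" by (simp add: p_def q_def)
  have c: "\<E> q q \<ge> 0" using q by (rule form_nonneg)
  define t where "t = - \<E> p q / (\<E> q q + 1)"
  have t: "t > 0" using b c by (simp add: t_def divide_neg_pos)
  have "0 \<le> t * (2 * \<E> p q + t * \<E> q q)"
    using ineq[of t] t by (simp add: algebra_simps power2_eq_square)
  then have "0 \<le> 2 * \<E> p q + t * \<E> q q" using t by (simp add: zero_le_mult_iff)
  moreover have "t * \<E> q q \<le> t * (\<E> q q + 1)" using t by simp
  moreover have "t * (\<E> q q + 1) = - \<E> p q" using c by (simp add: t_def)
  ultimately show False using b by linarith
qed

lemma form_remainder_nonneg:
  assumes u: "u \<in> D"
  shows "\<E> u (\<lambda>x. u x - unit_clamp (u x)) \<ge> 0"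
proof -
  let ?p = "\<lambda>x. unit_clamp (u x)" and ?q = "\<lambda>x. u x - unit_clamp (u x)"
  have p: "?p \<in> D" using u by (rule unit_clamp_dom)
  have q: "?q \<in> D" using u p by (rule dom_diff)
  have "\<E> u ?q = \<E> ?p ?q + \<E> ?q ?q" using form_add[OF p q q] by simp
  then show ?thesis using form_unit_clamp_remainder_nonneg[OF u] form_nonneg[OF q] by simp
qed

lemma form_unit_clamp_le:
  assumes u: "u \<in> D"
  shows "\<E> (\<lambda>x. unit_clamp (u x)) (\<lambda>x. unit_clamp (u x)) \<le> \<E> u (\<lambda>x. unit_clamp (u x))"
proof -
  let ?p = "\<lambda>x. unit_clamp (u x)" and ?q = "\<lambda>x. u x - unit_clamp (u x)"
  have p: "?p \<in> D" using u by (rule unit_clamp_dom)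
  have q: "?q \<in> D" using u p by (rule dom_diff)
  have "\<E> u ?p = \<E> ?p ?p + \<E> ?q ?p" using form_add[OF p q p] by simp
  then show ?thesis using form_unit_clamp_remainder_nonneg[OF u] form_sym[OF q p] by simp
qed

text \<open>The resolvent is sub-Markovian. Testing with the overshoot \<open>q = u - \<psi>(u)\<close>, for which
  \<open>\<E>(u,q) \<ge> 0\<close>, gives \<open>(\<alpha>u - h, q) \<le> 0\<close>, whereas \<open>0 \<le> h \<le> \<alpha>\<close> forces \<open>(\<alpha>u - h) q \<ge> \<alpha> q\<^sup>2\<close> pointwise.\<close>

lemma is_resolvent_unit_interval:
  assumes R: "is_resolvent \<alpha> h u" and h: "h \<in> L2 m" "AE x in m. 0 \<le> h x \<and> h x \<le> \<alpha>"
    and \<alpha>: "\<alpha> > 0"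
  shows "AE x in m. 0 \<le> u x \<and> u x \<le> 1"
proof -
  let ?q = "\<lambda>x. u x - unit_clamp (u x)"
  have u: "u \<in> D" using R by (simp add: is_resolvent_def)
  have q: "?q \<in> D" by (intro dom_diff unit_clamp_dom u)
  note L2s = dom_imp_L2[OF u] dom_imp_L2[OF q]
  have "L2_inner m h ?q = \<E> u ?q + \<alpha> * L2_inner m u ?q"
    using R q by (simp add: is_resolvent_def form_shift_def)
  then have le: "\<alpha> * L2_inner m u ?q - L2_inner m h ?q \<le> 0"
    using form_remainder_nonneg[OF u] by simp
  have "\<alpha> * L2_inner m ?q ?q \<le> \<alpha> * L2_inner m u ?q - L2_inner m h ?q"
  proof -
    have pt: "\<alpha> * (?q x * ?q x) \<le> \<alpha> * (u x * ?q x) - h x * ?q x" if "0 \<le> h x" "h x \<le> \<alpha>" for x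
    proof -
      have "0 \<le> (\<alpha> * unit_clamp (u x) - h x) * ?q x"
      proof -
        consider "u x < 0" | "0 \<le> u x" "u x \<le> 1" | "1 < u x" by linarith
        then show ?thesis
          by cases (use that in \<open>auto simp: unit_clamp_def mult_nonneg_nonpos\<close>)
      qed
      then show ?thesis by (simp add: algebra_simps)
    qed
    note I = L2_mult_integrable[OF L2s(2) L2s(2)] L2_mult_integrable[OF L2s]
      L2_mult_integrable[OF h(1) L2s(2)]
    have "(\<integral>x. \<alpha> * (?q x * ?q x) \<partial>m) \<le> (\<integral>x. \<alpha> * (u x * ?q x) - h x * ?q x \<partial>m)"
      using I by (intro integral_mono_AE) (use h(2) pt in auto)
    also have "\<dots> = \<alpha> * L2_inner m u ?q - L2_inner m h ?q"
      unfolding L2_inner_def using I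
      by (subst Bochner_Integration.integral_diff) auto
    finally show ?thesis unfolding L2_inner_def by simp
  qed
  with le have "\<alpha> * L2_inner m ?q ?q \<le> 0" by simp
  then have "L2_inner m ?q ?q \<le> 0" using \<alpha> by (simp add: mult_le_0_iff)
  from L2_inner_eq_0_imp_AE[OF dom_imp_L2[OF q] this] show ?thesis
  proof eventually_elim
    case (elim x)
    then show ?case using unit_clamp_bounds[of "u x"] by simp
  qed
qed

lemma is_resolvent_bounds:
  assumes R: "is_resolvent \<alpha> h u" and h: "h \<in> L2 m" "AE x in m. 0 \<le> h x \<and> h x \<le> c"
    and "\<alpha> > 0" "c > 0"
  shows "AE x in m. 0 \<le> u x \<and> u x \<le> c / \<alpha>"
proof -
  have "AE x in m. 0 \<le> \<alpha> / c * u x \<and> \<alpha> / c * u x \<le> 1"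
  proof (rule is_resolvent_unit_interval[OF is_resolvent_scale[OF R h(1)] L2_scale[OF h(1)]])
    show "AE x in m. 0 \<le> \<alpha> / c * h x \<and> \<alpha> / c * h x \<le> \<alpha>"
      using h(2) assms(4,5) by (auto simp: field_simps)
  qed fact
  then show ?thesis using assms(4,5) by (auto simp: field_simps zero_le_mult_iff)
qed

text \<open>Positivity is obtained from the sub-Markov property by scaling, so it is stated for bounded
  functions.\<close>

lemma resolvent_nonneg:
  assumes "h \<in> L2 m" "\<And>x. 0 \<le> h x" "\<And>x. h x \<le> c" "\<alpha> > 0"
  shows "AE x in m. 0 \<le> G \<alpha> h x"
proof -
  have "AE x in m. 0 \<le> h x \<and> h x \<le> \<bar>c\<bar> + 1"
  proof (rule AE_I2)
    show "0 \<le> h x \<and> h x \<le> \<bar>c\<bar> + 1" for x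
      using assms(2,3)[of x] by linarith
  qed
  then have "AE x in m. 0 \<le> G \<alpha> h x \<and> G \<alpha> h x \<le> (\<bar>c\<bar> + 1) / \<alpha>"
    by (intro is_resolvent_bounds[OF resolvent] assms) auto
  then show ?thesis by auto
qed

lemma resolvent_mono:
  assumes "h \<in> L2 m" "h' \<in> L2 m" "\<And>x. h x \<le> h' x" "\<And>x. h' x - h x \<le> c" "\<alpha> > 0"
  shows "AE x in m. G \<alpha> h x \<le> G \<alpha> h' x"
proof -
  have "AE x in m. 0 \<le> G \<alpha> (\<lambda>x. h' x + (-1) * h x) x"
    by (rule resolvent_nonneg[of _ c]) (use assms in \<open>auto simp: L2_diff\<close>)
  moreover have "AE x in m. G \<alpha> (\<lambda>x. h' x + (-1) * h x) x = G \<alpha> h' x + (-1) * G \<alpha> h x"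
    by (intro resolvent_lincomb assms)
  ultimately show ?thesis by auto
qed

lemma resolvent_antimono:
  assumes h: "h \<in> L2 m" "\<And>x. 0 \<le> h x" "\<And>x. h x \<le> c" and "0 < \<alpha>" "\<alpha> \<le> \<beta>"
  shows "AE x in m. G \<beta> h x \<le> G \<alpha> h x"
proof -
  define v where "v = G \<beta> h"
  define d where "d = (\<lambda>x. G \<alpha> h x + (-1) * v x)"
  have \<beta>: "\<beta> > 0" using assms by simp
  have v: "v \<in> D" "v \<in> L2 m"
    unfolding v_def using h(1) \<beta> resolvent_dom dom_imp_L2 by auto
  \<comment> \<open>The resolvent equation: \<open>G\<^sub>\<alpha> h - G\<^sub>\<beta> h = (\<beta> - \<alpha>) G\<^sub>\<alpha> G\<^sub>\<beta> h\<close>.\<close>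
  have d: "is_resolvent \<alpha> (\<lambda>x. (\<beta> - \<alpha>) * v x) d"
    unfolding is_resolvent_def
  proof safe
    show "d \<in> D" unfolding d_def using h(1) assms(4) v(1) by (intro dom_add dom_scale resolvent_dom)
    fix k assume k: "k \<in> D"
    have "form_shift \<alpha> d k = form_shift \<alpha> (G \<alpha> h) k + (-1) * form_shift \<alpha> v k"
      unfolding d_def using h(1) assms(4) v(1) k by (intro form_shift_lincomb resolvent_dom)
    also have "form_shift \<alpha> (G \<alpha> h) k = form_shift \<beta> v k"
      using resolvent[OF h(1) assms(4)] resolvent[OF h(1) \<beta>] k
      by (simp add: is_resolvent_def v_def)
    also have "\<dots> + (-1) * form_shift \<alpha> v k = L2_inner m (\<lambda>x. (\<beta> - \<alpha>) * v x) k"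
      by (simp only: L2_inner_scale) (simp add: form_shift_def algebra_simps)
    finally show "form_shift \<alpha> d k = L2_inner m (\<lambda>x. (\<beta> - \<alpha>) * v x) k" .
  qed
  define K where "K = \<bar>c\<bar> + 1"
  have "AE x in m. 0 \<le> h x \<and> h x \<le> K"
  proof (rule AE_I2)
    show "0 \<le> h x \<and> h x \<le> K" for x
      using h(2,3)[of x] unfolding K_def by linarith
  qed
  then have "AE x in m. 0 \<le> v x \<and> v x \<le> K / \<beta>"
    unfolding v_def by (intro is_resolvent_bounds[OF resolvent] h \<beta>) (auto simp: K_def)
  then have "AE x in m. 0 \<le> (\<beta> - \<alpha>) * v x \<and> (\<beta> - \<alpha>) * v x \<le> (\<beta> - \<alpha>) * (K / \<beta>) + 1"
  proof eventually_elim
    case (elim x)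
    then have "(\<beta> - \<alpha>) * v x \<le> (\<beta> - \<alpha>) * (K / \<beta>)" using assms(5) by (intro mult_left_mono) auto
    then show ?case using elim assms(5) by auto
  qed
  moreover have "(\<beta> - \<alpha>) * (K / \<beta>) + 1 > 0"
    using assms(5) \<beta> by (intro add_nonneg_pos mult_nonneg_nonneg) (auto simp: K_def)
  ultimately have "AE x in m. 0 \<le> d x \<and> d x \<le> ((\<beta> - \<alpha>) * (K / \<beta>) + 1) / \<alpha>"
    using is_resolvent_bounds[OF d L2_scale[OF v(2)]] assms(4) by blast
  then show ?thesis by (auto simp: d_def v_def)
qed

text \<open>A bound for \<open>G\<^sub>\<alpha> h\<close> on the set where \<open>h \<noteq> 0\<close> holds a.e.: the overshoot \<open>q = (u - 1)\<^sup>+\<close> of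
  \<open>u = G\<^sub>\<alpha> h / c\<close> vanishes there, so \<open>\<E>\<^sub>\<alpha>(u,q) = 0\<close>, while \<open>\<E>(u,q) \<ge> 0\<close> and
  \<open>u q \<ge> q\<^sup>2\<close>; hence \<open>q = 0\<close>.\<close>

lemma resolvent_maximum_principle:
  assumes h: "h \<in> L2 m" "\<And>x. 0 \<le> h x" "\<And>x. h x \<le> b" and \<alpha>: "\<alpha> > 0" and c: "c > 0"
    and le: "AE x in m. h x \<noteq> 0 \<longrightarrow> G \<alpha> h x \<le> c"
  shows "AE x in m. G \<alpha> h x \<le> c"
proof -
  define u where "u = (\<lambda>x. 1 / c * G \<alpha> h x)"
  let ?q = "\<lambda>x. u x - unit_clamp (u x)"
  have R: "is_resolvent \<alpha> (\<lambda>x. 1 / c * h x) u"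
    unfolding u_def using h(1) \<alpha> by (intro is_resolvent_scale resolvent)
  then have u: "u \<in> D" by (simp add: is_resolvent_def)
  have q: "?q \<in> D" by (intro dom_diff unit_clamp_dom u)
  note L2s = dom_imp_L2[OF u] dom_imp_L2[OF q]
  have nn: "AE x in m. 0 \<le> u x"
    using resolvent_nonneg[OF h \<alpha>] c by (auto simp: u_def)
  have "L2_inner m (\<lambda>x. 1 / c * h x) ?q = (\<integral>x. 0 \<partial>m)"
    unfolding L2_inner_def
  proof (rule integral_cong_AE)
    show "AE x in m. 1 / c * h x * ?q x = 0"
      using nn le
    proof eventually_elim
      case (elim x)
      then show ?case using c by (auto simp: u_def unit_clamp_def field_simps)
    qed
  qed (use h L2s in \<open>auto simp: L2_def\<close>)
  then have "\<E> u ?q + \<alpha> * L2_inner m u ?q = 0"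
    using R q by (simp add: is_resolvent_def form_shift_def)
  then have "\<alpha> * L2_inner m u ?q \<le> 0"
    using form_remainder_nonneg[OF u] by simp
  then have "L2_inner m u ?q \<le> 0" using \<alpha> by (simp add: mult_le_0_iff)
  moreover have "L2_inner m ?q ?q \<le> L2_inner m u ?q"
  proof (rule L2_inner_mono)
    show "AE x in m. ?q x * ?q x \<le> u x * ?q x"
      using nn by eventually_elim (auto simp: unit_clamp_def intro!: mult_right_mono)
  qed (use L2s in auto)
  ultimately have "AE x in m. ?q x = 0"
    using L2s by (intro L2_inner_eq_0_imp_AE) auto
  then show ?thesis
  proof eventually_elim
    case (elim x)
    then have "u x \<le> 1" using unit_clamp_bounds[of "u x"] by simp
    then show ?case using c by (simp add: u_def field_simps)
  qed
qed

subsection \<open>Extended resolvents and potentials of square-integrable functions\<close>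

text \<open>Whatever increasing sequence \<open>\<phi>\<^sub>n\<close> the extension to nonnegative functions selects, it converges to \<open>\<eta>\<close>
  in \<open>L\<^sup>2\<close> by dominated convergence, so \<open>G\<^sub>\<alpha> \<phi>\<^sub>n\<close> converges to \<open>G\<^sub>\<alpha> \<eta>\<close> in \<open>L\<^sup>2\<close> and its a.e. limit is
  determined.\<close>

lemma resolvent_nn_eq:
  assumes \<eta>: "\<eta> \<in> L2 m" "\<And>x. 0 \<le> \<eta> x" and \<alpha>: "\<alpha> > 0"
  shows "resolvent_nn m D \<E> \<alpha> (\<lambda>x. ennreal (\<eta> x)) \<in> borel_measurable m"
    and "AE x in m. resolvent_nn m D \<E> \<alpha> (\<lambda>x. ennreal (\<eta> x)) x = ennreal (G \<alpha> \<eta> x)"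
proof -
  define P where "P h \<longleftrightarrow> h \<in> borel_measurable m \<and>
        (\<exists>\<phi> :: nat \<Rightarrow> 'a \<Rightarrow> real.
           (\<forall>n. \<phi> n \<in> L2 m) \<and> (\<forall>n x. \<phi> n x \<ge> 0) \<and> incseq \<phi> \<and>
           (\<forall>x. (\<lambda>n. ennreal (\<phi> n x)) \<longlonglongrightarrow> ennreal (\<eta> x)) \<and>
           (AE x in m. (\<lambda>n. ennreal (G \<alpha> (\<phi> n) x)) \<longlonglongrightarrow> h x))" for h
  let ?h = "resolvent_nn m D \<E> \<alpha> (\<lambda>x. ennreal (\<eta> x))"
  have GM: "G \<alpha> \<eta> \<in> borel_measurable m"
    using \<eta> \<alpha> by (intro dom_measurable resolvent_dom)
  have "P (\<lambda>x. ennreal (G \<alpha> \<eta> x))"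
    unfolding P_def using \<eta> GM by (auto intro!: exI[of _ "\<lambda>n. \<eta>"] simp: incseq_def)
  then have "P ?h"
    unfolding resolvent_nn_def P_def[symmetric] by (rule someI[of P])
  then obtain \<phi> where meas: "?h \<in> borel_measurable m"
    and \<phi>: "\<And>n. \<phi> n \<in> L2 m" "\<And>n x. 0 \<le> \<phi> n x" "incseq \<phi>"
      "\<And>x. (\<lambda>n. ennreal (\<phi> n x)) \<longlonglongrightarrow> ennreal (\<eta> x)"
    and lim: "AE x in m. (\<lambda>n. ennreal (G \<alpha> (\<phi> n) x)) \<longlonglongrightarrow> ?h x"
    unfolding P_def by blast
  show "?h \<in> borel_measurable m" by (rule meas)
  have \<phi>_lim: "(\<lambda>n. \<phi> n x) \<longlonglongrightarrow> \<eta> x" for x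
    using \<phi>(4)[of x] \<phi>(2) \<eta>(2) by (subst (asm) tendsto_ennreal_iff) auto
  have \<phi>_le: "\<phi> n x \<le> \<eta> x" for n x
    using \<phi>(3) \<phi>_lim[of x] by (intro incseq_le[of "\<lambda>n. \<phi> n x"]) (auto simp: incseq_def le_fun_def)
  define d where "d n = (\<lambda>x. \<eta> x + (-1) * \<phi> n x)" for n
  define e where "e n = (\<lambda>x. G \<alpha> \<eta> x + (-1) * G \<alpha> (\<phi> n) x)" for n
  have d_L2: "d n \<in> L2 m" for n
    unfolding d_def by (intro L2_add L2_scale \<eta> \<phi>)
  have e: "is_resolvent \<alpha> (d n) (e n)" for n
    unfolding d_def e_def by (intro is_resolvent_lincomb resolvent \<eta> \<phi> \<alpha>)
  then have e_L2: "e n \<in> L2 m" for n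
    using dom_imp_L2 by (auto simp: is_resolvent_def)
  have "(\<lambda>n. L2_inner m (d n) (d n)) \<longlonglongrightarrow> (\<integral>x. 0 \<partial>m)"
    unfolding L2_inner_def
  proof (rule integral_dominated_convergence[where w = "\<lambda>x. \<eta> x * \<eta> x"])
    show "AE x in m. (\<lambda>n. d n x * d n x) \<longlonglongrightarrow> 0"
    proof (rule AE_I2)
      fix x
      have "(\<lambda>n. \<eta> x - \<phi> n x) \<longlonglongrightarrow> \<eta> x - \<eta> x" by (intro tendsto_intros \<phi>_lim)
      then show "(\<lambda>n. d n x * d n x) \<longlonglongrightarrow> 0"
        using tendsto_mult[of "\<lambda>n. d n x" 0 _ "\<lambda>n. d n x" 0] by (simp add: d_def)
    qed
    have [measurable]: "d n \<in> borel_measurable m" for n using d_L2 by (simp add: L2_def)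
    show "(\<lambda>x. d n x * d n x) \<in> borel_measurable m" for n by measurable
    show "AE x in m. norm (d n x * d n x) \<le> \<eta> x * \<eta> x" for n
    proof (rule AE_I2)
      fix x
      have "0 \<le> d n x" "d n x \<le> \<eta> x"
        using \<phi>_le[of n x] \<phi>(2)[of n x] by (auto simp: d_def)
      then show "norm (d n x * d n x) \<le> \<eta> x * \<eta> x" by (simp add: mult_mono)
    qed
  qed (use L2_mult_integrable[OF \<eta>(1) \<eta>(1)] in auto)
  then have "(\<lambda>n. L2_inner m (d n) (d n) / \<alpha>\<^sup>2) \<longlonglongrightarrow> 0"
    using tendsto_divide[of _ 0 sequentially "\<lambda>_. \<alpha>\<^sup>2" "\<alpha>\<^sup>2"] \<alpha> by simp
  moreover have "L2_inner m (e n) (e n) \<le> L2_inner m (d n) (d n) / \<alpha>\<^sup>2" for n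
    using is_resolvent_L2_bound[OF e[of n] d_L2 \<alpha>] \<alpha> by (simp add: field_simps)
  ultimately have "(\<lambda>n. L2_inner m (e n) (e n)) \<longlonglongrightarrow> 0"
    by (intro tendsto_sandwich[of "\<lambda>_. 0" "\<lambda>n. L2_inner m (e n) (e n)"])
      (simp_all add: L2_inner_nonneg)
  then have "(\<lambda>n. \<integral>x. norm (e n x * e n x) \<partial>m) \<longlonglongrightarrow> 0"
    by (simp add: L2_inner_def)
  from tendsto_L1_AE_subseq[OF L2_mult_integrable[OF e_L2 e_L2] this]
  obtain r where r: "strict_mono r" "AE x in m. (\<lambda>n. e (r n) x * e (r n) x) \<longlonglongrightarrow> 0"
    by auto
  show "AE x in m. ?h x = ennreal (G \<alpha> \<eta> x)"
    using lim r(2)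
  proof eventually_elim
    case (elim x)
    have "(\<lambda>n. (e (r n) x)\<^sup>2) \<longlonglongrightarrow> 0" using elim(2) by (simp add: power2_eq_square)
    then have "(\<lambda>n. e (r n) x) \<longlonglongrightarrow> 0" by simp
    then have "(\<lambda>n. G \<alpha> \<eta> x - e (r n) x) \<longlonglongrightarrow> G \<alpha> \<eta> x - 0" by (intro tendsto_intros)
    then have "(\<lambda>n. G \<alpha> (\<phi> (r n)) x) \<longlonglongrightarrow> G \<alpha> \<eta> x" by (simp add: e_def)
    then have "(\<lambda>n. ennreal (G \<alpha> (\<phi> (r n)) x)) \<longlonglongrightarrow> ennreal (G \<alpha> \<eta> x)"
      by (rule tendsto_ennrealI)
    moreover have "(\<lambda>n. ennreal (G \<alpha> (\<phi> (r n)) x)) \<longlonglongrightarrow> ?h x"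
      using LIMSEQ_subseq_LIMSEQ[OF elim(1) r(1)] by (simp add: o_def)
    ultimately show ?case by (rule LIMSEQ_unique[rotated])
  qed
qed

text \<open>Since \<open>G\<^sub>\<alpha>\<close> increases as \<open>\<alpha>\<close> decreases to \<open>0\<close>, the supremum over all \<open>\<alpha> > 0\<close> that defines
  the potential can be taken along \<open>\<alpha> = 1/(n+1)\<close>; countably many exceptional null sets are harmless.\<close>

abbreviation "G_seq \<eta> n \<equiv> G (1 / real (Suc n)) \<eta>"

lemma G_seq_measurable: "\<eta> \<in> L2 m \<Longrightarrow> G_seq \<eta> n \<in> borel_measurable m"
  by (intro dom_measurable resolvent_dom) auto

lemma G_seq_incseq:
  assumes "\<eta> \<in> L2 m" "\<And>x. 0 \<le> \<eta> x" "\<And>x. \<eta> x \<le> c"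
  shows "AE x in m. incseq (\<lambda>n. G_seq \<eta> n x)"
proof -
  have "AE x in m. \<forall>n. G_seq \<eta> n x \<le> G_seq \<eta> (Suc n) x"
    unfolding AE_all_countable using assms
    by (intro allI resolvent_antimono) (auto simp: field_simps)
  then show ?thesis by (auto simp: incseq_Suc_iff)
qed

lemma potential_nn_eq:
  assumes \<eta>: "\<eta> \<in> L2 m" "\<And>x. 0 \<le> \<eta> x" "\<And>x. \<eta> x \<le> c"
  shows "potential_nn m D \<E> (\<lambda>x. ennreal (\<eta> x)) \<in> borel_measurable m"
    and "AE x in m. potential_nn m D \<E> (\<lambda>x. ennreal (\<eta> x)) x = (SUP n. ennreal (G_seq \<eta> n x))"
proof -
  let ?F = "(\<lambda>\<alpha>. resolvent_nn m D \<E> \<alpha> (\<lambda>x. ennreal (\<eta> x))) ` {0<..}"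
  let ?p = "potential_nn m D \<E> (\<lambda>x. ennreal (\<eta> x))"
  let ?s = "\<lambda>x. SUP n. ennreal (G_seq \<eta> n x)"
  have s: "is_ae_sup m ?F ?s"
    unfolding is_ae_sup_def
  proof (intro conjI ballI impI)
    have [measurable]: "G_seq \<eta> n \<in> borel_measurable m" for n
      by (rule G_seq_measurable[OF \<eta>(1)])
    show "?s \<in> borel_measurable m" by measurable
  next
    fix r assume "r \<in> ?F"
    then obtain \<alpha> where \<alpha>: "\<alpha> > 0" "r = resolvent_nn m D \<E> \<alpha> (\<lambda>x. ennreal (\<eta> x))" by auto
    obtain n where n: "1 / real (Suc n) < \<alpha>"
      using reals_Archimedean[OF \<alpha>(1)] by (auto simp: inverse_eq_divide)
    have "AE x in m. G \<alpha> \<eta> x \<le> G_seq \<eta> n x"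
      using n by (intro resolvent_antimono[OF \<eta>]) auto
    with resolvent_nn_eq(2)[OF \<eta>(1,2) \<alpha>(1)] show "AE x in m. r x \<le> ?s x"
    proof eventually_elim
      case (elim x)
      then have "r x \<le> ennreal (G_seq \<eta> n x)" by (simp add: \<alpha>(2) ennreal_leI)
      also have "\<dots> \<le> ?s x" by (intro SUP_upper) auto
      finally show ?case .
    qed
  next
    fix k assume k: "k \<in> borel_measurable m" "\<forall>r\<in>?F. AE x in m. r x \<le> k x"
    have "AE x in m. \<forall>n. ennreal (G_seq \<eta> n x) \<le> k x"
      unfolding AE_all_countable
    proof
      fix n
      have "AE x in m. resolvent_nn m D \<E> (1 / real (Suc n)) (\<lambda>x. ennreal (\<eta> x)) x \<le> k x"
        using k(2) by auto
      with resolvent_nn_eq(2)[OF \<eta>(1,2), of "1 / real (Suc n)"]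
      show "AE x in m. ennreal (G_seq \<eta> n x) \<le> k x" by auto
    qed
    then show "AE x in m. ?s x \<le> k x" by eventually_elim (auto intro: SUP_least)
  qed
  then have p: "is_ae_sup m ?F ?p"
    unfolding potential_nn_def by (rule someI[of "is_ae_sup m ?F"])
  then show "?p \<in> borel_measurable m" by (simp add: is_ae_sup_def)
  have "AE x in m. ?p x \<le> ?s x" "AE x in m. ?s x \<le> ?p x"
    using s p by (auto simp: is_ae_sup_def)
  then show "AE x in m. ?p x = ?s x" by eventually_elim auto
qed

end

section \<open>Transient forms\<close>

text \<open>The reference function \<open>g\<close> is required to be nonnegative at every point, not only a.e., so that bounds
  by multiples of \<open>g\<close> can be stated pointwise.\<close>

locale transient_dirichlet_form = symmetric_dirichlet_form m D \<E>
  for m :: "'a measure" and D \<E> +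
  fixes g :: "'a \<Rightarrow> real" and C :: real
  assumes reference_integrable: "integrable m g"
    and reference_nonneg: "\<And>x. 0 \<le> g x"
    and reference_le: "\<And>x. g x \<le> C"
    and reference_pos: "AE x in m. 0 < g x"
    and reference_energy: "\<And>u. u \<in> D \<Longrightarrow> (\<integral>x. \<bar>u x\<bar> * g x \<partial>m) \<le> sqrt (\<E> u u)"
begin

lemma reference_L2: "g \<in> L2 m"
  using reference_nonneg reference_le
  by (intro bounded_integrable_L2[OF reference_integrable, of C]) (simp add: abs_of_nonneg)

text \<open>For \<open>s = (g, G\<^sub>\<alpha> g)\<close> transience gives \<open>s \<le> \<E>(G\<^sub>\<alpha> g, G\<^sub>\<alpha> g)\<^bsup>1/2\<^esup> \<le> s\<^bsup>1/2\<^esup>\<close>. The bound does not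
  depend on \<open>\<alpha>\<close>, which is what makes the potential of \<open>g\<close> finite.\<close>

lemma reference_energy_le_1:
  assumes \<alpha>: "\<alpha> > 0"
  shows "L2_inner m g (G \<alpha> g) \<le> 1"
proof -
  let ?u = "G \<alpha> g" and ?s = "L2_inner m g (G \<alpha> g)"
  have u: "?u \<in> D" using reference_L2 \<alpha> by (rule resolvent_dom)
  have s: "form_shift \<alpha> ?u ?u = ?s"
    using resolvent[OF reference_L2 \<alpha>] u by (simp add: is_resolvent_def)
  have "0 \<le> ?s" using form_shift_nonneg[OF u, of \<alpha>] \<alpha> s by simp
  have "?s \<le> (\<integral>x. \<bar>?u x\<bar> * g x \<partial>m)"
    unfolding L2_inner_def
  proof (rule integral_mono)
    show "integrable m (\<lambda>x. \<bar>?u x\<bar> * g x)"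
      using integrable_abs[OF L2_mult_integrable[OF dom_imp_L2[OF u] reference_L2]] reference_nonneg
      by (simp add: abs_mult)
    show "g x * ?u x \<le> \<bar>?u x\<bar> * g x" for x
      using reference_nonneg[of x] mult_right_mono[of "?u x" "\<bar>?u x\<bar>" "g x"]
      by (simp add: mult.commute)
  qed (intro L2_mult_integrable reference_L2 dom_imp_L2 u)
  also have "\<dots> \<le> sqrt (\<E> ?u ?u)" using u by (rule reference_energy)
  also have "\<dots> \<le> sqrt ?s"
  proof -
    have "0 \<le> \<alpha> * L2_inner m ?u ?u" using \<alpha> L2_inner_nonneg[of m ?u] by simp
    then have "\<E> ?u ?u \<le> ?s" using s unfolding form_shift_def by linarith
    then show ?thesis by simp
  qed
  finally have "?s\<^sup>2 \<le> (sqrt ?s)\<^sup>2" using \<open>0 \<le> ?s\<close> by (intro power_mono)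
  then have "?s * ?s \<le> 1 * ?s" using \<open>0 \<le> ?s\<close> by (simp add: power2_eq_square)
  then show ?thesis
    using \<open>0 \<le> ?s\<close> by (cases "?s = 0") (auto simp: mult_le_cancel_right)
qed

subsection \<open>Test functions with bounded potential\<close>

text \<open>The sublevel set \<open>{Gg \<le> k+1}\<close>; the shift by one keeps the bound positive for \<open>k = 0\<close>, as the
  maximum principle requires.\<close>

definition sublevel :: "nat \<Rightarrow> 'a set" where
  "sublevel k = {x \<in> space m. \<forall>n. G_seq g n x \<le> real k + 1}"

lemma sublevel_sets [measurable]: "sublevel k \<in> sets m"
proof -
  have [measurable]: "G_seq g n \<in> borel_measurable m" for n
    by (rule G_seq_measurable[OF reference_L2])
  show ?thesis unfolding sublevel_def by measurable
qed

lemma sublevel_mono: "k \<le> l \<Longrightarrow> sublevel k \<subseteq> sublevel l"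
proof
  fix x assume "k \<le> l" and x: "x \<in> sublevel k"
  then have le: "real k + 1 \<le> real l + 1" by simp
  have "G_seq g n x \<le> real l + 1" for n
    by (rule order_trans[OF _ le]) (use x in \<open>simp add: sublevel_def\<close>)
  then show "x \<in> sublevel l" using x by (simp add: sublevel_def)
qed

text \<open>Monotone convergence in \<open>(g, G\<^sub>\<alpha> g) \<le> 1\<close> shows that \<open>g \<cdot> Gg\<close> has a finite integral, and \<open>g > 0\<close>.\<close>

lemma AE_in_sublevel: "AE x in m. \<exists>k. x \<in> sublevel k"
proof -
  have [measurable]: "G_seq g n \<in> borel_measurable m" "g \<in> borel_measurable m" for n
    using G_seq_measurable[OF reference_L2] reference_integrable by auto
  have nn: "AE x in m. \<forall>n. 0 \<le> G_seq g n x"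
    unfolding AE_all_countable
    by (intro allI resolvent_nonneg[OF reference_L2 reference_nonneg reference_le]) auto
  have inc: "AE x in m. incseq (\<lambda>n. G_seq g n x)"
    by (rule G_seq_incseq[OF reference_L2 reference_nonneg reference_le])
  have int: "integrable m (\<lambda>x. g x * G_seq g n x)" for n
    by (intro L2_mult_integrable reference_L2 dom_imp_L2 resolvent_dom) auto
  have le1: "(\<integral>\<^sup>+x. ennreal (g x * G_seq g n x) \<partial>m) \<le> 1" for n
  proof -
    have "AE x in m. 0 \<le> g x * G_seq g n x"
      using nn reference_nonneg by auto
    then have "(\<integral>\<^sup>+x. ennreal (g x * G_seq g n x) \<partial>m) = ennreal (L2_inner m g (G_seq g n))"
      unfolding L2_inner_def by (intro nn_integral_eq_integral int)
    also have "\<dots> \<le> ennreal 1" by (intro ennreal_leI reference_energy_le_1) auto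
    finally show ?thesis by simp
  qed
  have "(\<integral>\<^sup>+x. (SUP n. ennreal (g x * G_seq g n x)) \<partial>m) =
      (SUP n. \<integral>\<^sup>+x. ennreal (g x * G_seq g n x) \<partial>m)"
  proof (rule nn_integral_monotone_convergence_SUP_AE)
    show "AE x in m. ennreal (g x * G_seq g n x) \<le> ennreal (g x * G_seq g (Suc n) x)" for n
      using inc by eventually_elim
        (use reference_nonneg in \<open>auto intro!: ennreal_leI mult_left_mono dest: incseq_SucD\<close>)
  qed measurable
  also have "\<dots> \<le> 1" using le1 by (intro SUP_least)
  finally have "(\<integral>\<^sup>+x. (SUP n. ennreal (g x * G_seq g n x)) \<partial>m) \<noteq> \<infinity>"
    by (auto simp: top_unique)
  then have "AE x in m. (SUP n. ennreal (g x * G_seq g n x)) \<noteq> \<infinity>"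
    by (intro nn_integral_PInf_AE) measurable
  then show ?thesis
    using reference_pos nn AE_space
  proof eventually_elim
    case (elim x)
    let ?S = "SUP n. ennreal (g x * G_seq g n x)"
    define M where "M = enn2real ?S"
    have M: "?S = ennreal M" using elim(1) unfolding M_def infinity_ennreal_def less_top by (rule ennreal_enn2real[symmetric])
    have "g x * G_seq g n x \<le> M" for n
    proof -
      have "ennreal (g x * G_seq g n x) \<le> ennreal M"
        unfolding M[symmetric] by (intro SUP_upper) auto
      then show ?thesis by (subst (asm) ennreal_le_iff) (simp_all add: M_def)
    qed
    then have "G_seq g n x \<le> M / g x" for n using elim(2) by (simp add: field_simps)
    moreover obtain k :: nat where "M / g x \<le> real k" using real_arch_simple by blast
    ultimately have "G_seq g n x \<le> real k + 1" for n
      by (meson add_increasing2 order_trans zero_le_one)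
    then show ?case using elim(4) by (auto simp: sublevel_def)
  qed
qed

definition truncated_reference :: "nat \<Rightarrow> 'a \<Rightarrow> real" where
  "truncated_reference k x = g x * indicator (sublevel k) x"

lemma truncated_reference_measurable [measurable]: "truncated_reference k \<in> borel_measurable m"
  using reference_integrable unfolding truncated_reference_def by measurable

lemma truncated_reference_bounds:
  "0 \<le> truncated_reference k x" "truncated_reference k x \<le> g x" "truncated_reference k x \<le> C"
  using reference_nonneg[of x] reference_le[of x] by (auto simp: truncated_reference_def indicator_def)

lemma truncated_reference_integrable: "integrable m (truncated_reference k)"
  by (rule Bochner_Integration.integrable_bound[OF reference_integrable])
    (use truncated_reference_bounds reference_nonneg in auto)

lemma truncated_reference_L2: "truncated_reference k \<in> L2 m"
  by (rule bounded_integrable_L2[OF truncated_reference_integrable, of _ C]) (use truncated_reference_bounds in auto)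

text \<open>On the sublevel set the bound holds because \<open>g\<close> dominates its truncation; the maximum principle extends
  it to the whole space.\<close>

lemma resolvent_truncated_reference_le: "AE x in m. G_seq (truncated_reference k) n x \<le> real k + 1"
proof (rule resolvent_maximum_principle[OF truncated_reference_L2 truncated_reference_bounds(1,3)])
  have "AE x in m. G_seq (truncated_reference k) n x \<le> G_seq g n x"
    by (rule resolvent_mono[OF truncated_reference_L2 reference_L2 truncated_reference_bounds(2), where c = C])
      (use truncated_reference_bounds(1)[of k] reference_le in \<open>auto simp: diff_le_eq add_increasing2\<close>)
  then show "AE x in m. truncated_reference k x \<noteq> 0 \<longrightarrow> G_seq (truncated_reference k) n x \<le> real k + 1"
  proof eventually_elim
    case (elim x)
    have "G_seq g n x \<le> real k + 1" if "truncated_reference k x \<noteq> 0"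
      using that by (auto simp: truncated_reference_def sublevel_def indicator_def split: if_splits)
    then show ?case using elim by (blast intro: order_trans)
  qed
qed auto

text \<open>The test functions: they are integrable and bounded, and their potentials are bounded.\<close>

definition dominated :: "real \<Rightarrow> nat \<Rightarrow> ('a \<Rightarrow> real) \<Rightarrow> bool" where
  "dominated c k \<eta> \<longleftrightarrow> \<eta> \<in> borel_measurable m \<and> (\<forall>x. \<bar>\<eta> x\<bar> \<le> c * truncated_reference k x)"

lemma dominated_integrable:
  assumes "dominated c k \<eta>" shows "integrable m \<eta>"
proof (rule Bochner_Integration.integrable_bound)
  show "integrable m (\<lambda>x. c * truncated_reference k x)" using truncated_reference_integrable by simp
  show "AE x in m. norm (\<eta> x) \<le> norm (c * truncated_reference k x)"
    using assms by (auto simp: dominated_def intro!: AE_I2 order_trans[OF _ abs_ge_self])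
qed (use assms in \<open>simp add: dominated_def\<close>)

lemma dominated_bound:
  assumes "dominated c k \<eta>" "c \<ge> 0" shows "\<bar>\<eta> x\<bar> \<le> c * C"
  using assms(1) mult_left_mono[OF truncated_reference_bounds(3)[of k x] assms(2)]
  by (simp add: dominated_def) (meson order_trans)

lemma dominated_L2:
  assumes "dominated c k \<eta>" "c \<ge> 0" shows "\<eta> \<in> L2 m"
  by (rule bounded_integrable_L2[OF dominated_integrable[OF assms(1)] dominated_bound[OF assms]])

lemma dominated_resolvent_bound:
  assumes \<eta>: "dominated c k \<eta>" "c \<ge> 0"
  shows "AE x in m. \<bar>G_seq \<eta> n x\<bar> \<le> c * (real k + 1)"
proof -
  have \<eta>_le: "\<bar>\<eta> x\<bar> \<le> c * truncated_reference k x" "c * truncated_reference k x \<le> c * C" for x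
    using \<eta> mult_left_mono[OF truncated_reference_bounds(3)[of k x] \<eta>(2)] by (simp_all add: dominated_def)
  note L = dominated_L2[OF \<eta>]
  have "AE x in m. G_seq \<eta> n x \<le> G_seq (\<lambda>x. c * truncated_reference k x) n x"
  proof (rule resolvent_mono[OF L L2_scale[OF truncated_reference_L2], where c = "2 * (c * C)"])
    show "\<eta> x \<le> c * truncated_reference k x" "c * truncated_reference k x - \<eta> x \<le> 2 * (c * C)" for x
      using \<eta>_le[of x] by linarith+
  qed simp
  moreover have "AE x in m. G_seq (\<lambda>x. (-c) * truncated_reference k x) n x \<le> G_seq \<eta> n x"
  proof (rule resolvent_mono[OF L2_scale[OF truncated_reference_L2] L, where c = "2 * (c * C)"])
    show "(-c) * truncated_reference k x \<le> \<eta> x" "\<eta> x - (-c) * truncated_reference k x \<le> 2 * (c * C)" for x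
      using \<eta>_le[of x] by (simp_all add: abs_le_iff)
  qed simp
  moreover have "AE x in m. G_seq (\<lambda>x. b * truncated_reference k x) n x = b * G_seq (truncated_reference k) n x" for b
    by (rule resolvent_scale[OF truncated_reference_L2]) simp
  note this[of c] this[of "-c"]
  ultimately show ?thesis
    using resolvent_truncated_reference_le[of n k]
  proof eventually_elim
    case (elim x)
    have "c * G_seq (truncated_reference k) n x \<le> c * (real k + 1)"
      using elim \<eta>(2) by (intro mult_left_mono)
    with elim show ?case by (auto simp: abs_le_iff)
  qed
qed

lemma dominated_abs: "dominated c k \<eta> \<Longrightarrow> dominated c k (\<lambda>x. \<bar>\<eta> x\<bar>)"
  by (auto simp: dominated_def)

lemma dominated_potential_nn_bound:
  assumes \<eta>: "dominated c k \<eta>" "c \<ge> 0" and nn: "\<And>x. 0 \<le> \<eta> x"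
  shows "AE x in m. potential_nn m D \<E> (\<lambda>x. ennreal (\<eta> x)) x \<le> ennreal (c * (real k + 1))"
proof -
  have le: "\<eta> x \<le> c * C" for x using dominated_bound[OF \<eta>, of x] by simp
  have "AE x in m. \<forall>n. \<bar>G_seq \<eta> n x\<bar> \<le> c * (real k + 1)"
    unfolding AE_all_countable by (intro allI dominated_resolvent_bound \<eta>)
  with potential_nn_eq(2)[OF dominated_L2[OF \<eta>] nn le] show ?thesis
  proof eventually_elim
    case (elim x)
    show ?case unfolding elim(1)
    proof (intro SUP_least ennreal_leI)
      fix n
      show "G_seq \<eta> n x \<le> c * (real k + 1)" using elim(2)[rule_format, of n] by linarith
    qed
  qed
qed

text \<open>Boundedness of the potential is essential here, as the conversion from extended to real numbers sends
  \<open>\<infinity>\<close> to \<open>0\<close>.\<close>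

lemma dominated_nonneg_limit:
  assumes \<eta>: "dominated c k \<eta>" "c \<ge> 0" and nn: "\<And>x. 0 \<le> \<eta> x"
  shows "AE x in m. (\<lambda>n. G_seq \<eta> n x) \<longlonglongrightarrow>
    enn2real (potential_nn m D \<E> (\<lambda>x. ennreal (\<eta> x)) x)"
proof -
  have le: "\<eta> x \<le> c * C" for x using dominated_bound[OF \<eta>, of x] by simp
  note L = dominated_L2[OF \<eta>]
  have "AE x in m. \<forall>n. 0 \<le> G_seq \<eta> n x"
    unfolding AE_all_countable by (intro allI resolvent_nonneg[OF L nn le]) auto
  with potential_nn_eq(2)[OF L nn le] G_seq_incseq[OF L nn le] dominated_potential_nn_bound[OF \<eta> nn]
  show ?thesis
  proof eventually_elim
    case (elim x)
    let ?p = "potential_nn m D \<E> (\<lambda>x. ennreal (\<eta> x)) x"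
    have "(\<lambda>n. ennreal (G_seq \<eta> n x)) \<longlonglongrightarrow> ?p"
      unfolding elim(1) using elim(2)
      by (intro LIMSEQ_SUP) (auto simp: incseq_def intro: ennreal_leI)
    moreover have "?p \<noteq> top" using elim(3) by (auto simp: top_unique)
    ultimately have "(\<lambda>n. enn2real (ennreal (G_seq \<eta> n x))) \<longlonglongrightarrow> enn2real ?p"
      by (intro tendsto_enn2real) (auto simp: less_top)
    then show ?case using elim(4) by simp
  qed
qed

lemma dominated_potential:
  assumes \<eta>: "dominated c k \<eta>" "c \<ge> 0"
  shows "potential m D \<E> \<eta> \<in> borel_measurable m"
    and "AE x in m. (\<lambda>n. G_seq \<eta> n x) \<longlonglongrightarrow> potential m D \<E> \<eta> x"
    and "AE x in m. \<bar>potential m D \<E> \<eta> x\<bar> \<le> c * (real k + 1)"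
proof -
  define p where "p = (\<lambda>x. max (\<eta> x) 0)"
  define q where "q = (\<lambda>x. max (- \<eta> x) 0)"
  have pq: "dominated c k p" "dominated c k q" "\<And>x. 0 \<le> p x" "\<And>x. 0 \<le> q x"
    using \<eta> truncated_reference_bounds(1)[of k] by (auto simp: dominated_def p_def q_def abs_le_iff)
  have le: "p x \<le> c * C" "q x \<le> c * C" for x
    using dominated_bound[OF pq(1) \<eta>(2), of x] dominated_bound[OF pq(2) \<eta>(2), of x] by simp_all
  note L = dominated_L2[OF pq(1) \<eta>(2)] dominated_L2[OF pq(2) \<eta>(2)]
  have e: "(\<lambda>y. ennreal (\<eta> y)) = (\<lambda>y. ennreal (p y))" "(\<lambda>y. ennreal (- \<eta> y)) = (\<lambda>y. ennreal (q y))"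
    by (auto simp: p_def q_def fun_eq_iff max_def ennreal_neg)
  have pot: "potential m D \<E> \<eta> =
      (\<lambda>x. enn2real (potential_nn m D \<E> (\<lambda>y. ennreal (p y)) x) -
           enn2real (potential_nn m D \<E> (\<lambda>y. ennreal (q y)) x))"
    unfolding potential_def[abs_def] e ..
  show "potential m D \<E> \<eta> \<in> borel_measurable m"
    unfolding pot using potential_nn_eq(1)[OF L(1) pq(3) le(1)] potential_nn_eq(1)[OF L(2) pq(4) le(2)]
    by measurable
  have \<eta>_eq: "\<eta> = (\<lambda>x. p x + (-1) * q x)" by (auto simp: p_def q_def fun_eq_iff)
  have "AE x in m. \<forall>n. G_seq \<eta> n x = G_seq p n x + (-1) * G_seq q n x"
    unfolding AE_all_countable \<eta>_eq by (intro allI resolvent_lincomb L) auto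
  with dominated_nonneg_limit[OF pq(1) \<eta>(2) pq(3)] dominated_nonneg_limit[OF pq(2) \<eta>(2) pq(4)]
  show lim: "AE x in m. (\<lambda>n. G_seq \<eta> n x) \<longlonglongrightarrow> potential m D \<E> \<eta> x"
  proof eventually_elim
    case (elim x)
    show ?case using tendsto_diff[OF elim(1,2)] elim(3) by (simp add: pot)
  qed
  have "AE x in m. \<forall>n. \<bar>G_seq \<eta> n x\<bar> \<le> c * (real k + 1)"
    unfolding AE_all_countable by (intro allI dominated_resolvent_bound \<eta>)
  with lim show "AE x in m. \<bar>potential m D \<E> \<eta> x\<bar> \<le> c * (real k + 1)"
  proof eventually_elim
    case (elim x)
    show ?case
      using tendsto_rabs[OF elim(1)] elim(2) by (intro LIMSEQ_le_const2) auto
  qed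
qed

lemma integrable_mult_potential:
  assumes \<eta>: "dominated c k \<eta>" "c \<ge> 0" and H: "integrable m H"
  shows "integrable m (\<lambda>x. H x * potential m D \<E> \<eta> x)"
proof (rule Bochner_Integration.integrable_bound)
  show "integrable m (\<lambda>x. c * (real k + 1) * \<bar>H x\<bar>)" using H by auto
  show "(\<lambda>x. H x * potential m D \<E> \<eta> x) \<in> borel_measurable m"
    using H dominated_potential(1)[OF \<eta>] by auto
  show "AE x in m. norm (H x * potential m D \<E> \<eta> x) \<le> norm (c * (real k + 1) * \<bar>H x\<bar>)"
    using dominated_potential(3)[OF \<eta>]
  proof eventually_elim
    case (elim x)
    have "\<bar>H x\<bar> * \<bar>potential m D \<E> \<eta> x\<bar> \<le> \<bar>H x\<bar> * (c * (real k + 1))"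
      using elim by (intro mult_left_mono) auto
    then show ?case using \<eta>(2) by (simp add: abs_mult mult.commute)
  qed
qed

lemma potential_symmetric:
  assumes h: "dominated b j h" "b \<ge> 0" and \<eta>: "dominated c k \<eta>" "c \<ge> 0"
  shows "(\<integral>x. potential m D \<E> h x * \<eta> x \<partial>m) = (\<integral>x. h x * potential m D \<E> \<eta> x \<partial>m)"
proof -
  have lim: "(\<lambda>n. \<integral>x. G_seq h n x * \<eta> x \<partial>m) \<longlonglongrightarrow> (\<integral>x. potential m D \<E> h x * \<eta> x \<partial>m)"
    if h: "dominated b j h" "b \<ge> 0" and \<eta>: "dominated c k \<eta>" "c \<ge> 0" for b c j k h \<eta>
  proof (rule integral_dominated_convergence[where w = "\<lambda>x. b * (real j + 1) * \<bar>\<eta> x\<bar>"])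
    have [measurable]: "\<eta> \<in> borel_measurable m" "potential m D \<E> h \<in> borel_measurable m"
      "G_seq h n \<in> borel_measurable m" for n
      using \<eta> dominated_potential(1)[OF h] G_seq_measurable[OF dominated_L2[OF h]]
      by (auto simp: dominated_def)
    show "(\<lambda>x. potential m D \<E> h x * \<eta> x) \<in> borel_measurable m"
      "(\<lambda>x. G_seq h n x * \<eta> x) \<in> borel_measurable m" for n by measurable
    show "integrable m (\<lambda>x. b * (real j + 1) * \<bar>\<eta> x\<bar>)"
      using dominated_integrable[OF \<eta>(1)] by auto
    show "AE x in m. (\<lambda>n. G_seq h n x * \<eta> x) \<longlonglongrightarrow> potential m D \<E> h x * \<eta> x"
      using dominated_potential(2)[OF h] by eventually_elim (intro tendsto_intros)
    show "AE x in m. norm (G_seq h n x * \<eta> x) \<le> b * (real j + 1) * \<bar>\<eta> x\<bar>" for n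
      using dominated_resolvent_bound[OF h, of n]
      by eventually_elim (auto simp: abs_mult intro!: mult_right_mono)
  qed
  have "(\<lambda>n. \<integral>x. G_seq h n x * \<eta> x \<partial>m) = (\<lambda>n. \<integral>x. G_seq \<eta> n x * h x \<partial>m)"
  proof
    fix n
    show "(\<integral>x. G_seq h n x * \<eta> x \<partial>m) = (\<integral>x. G_seq \<eta> n x * h x \<partial>m)"
      using resolvent_symmetric[OF dominated_L2[OF h] dominated_L2[OF \<eta>], of "1 / real (Suc n)"]
      by (simp add: L2_inner_def mult.commute)
  qed
  with lim[OF h \<eta>] lim[OF \<eta> h] show ?thesis
    by (simp add: LIMSEQ_unique mult.commute)
qed

text \<open>At level \<open>\<alpha> > 0\<close>, with \<open>u = G\<^sub>\<alpha> h\<close> and \<open>q = \<psi>(u)\<close>, transience and the Markov property give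
  \<open>(\<integral> q g dm)\<^sup>2 \<le> \<E>(q,q) \<le> \<E>(u,q) \<le> \<E>\<^sub>\<alpha>(u,q) = (h,q)\<close>. All integrands are dominated by \<open>g\<close> or \<open>|h|\<close>
  uniformly in \<open>\<alpha>\<close>, so \<open>\<alpha>\<close> may tend to \<open>0\<close>.\<close>

lemma potential_clamp_inequality:
  assumes h: "dominated b j h" "b \<ge> 0"
  defines "p \<equiv> \<lambda>x. unit_clamp (potential m D \<E> h x)"
  shows "(\<integral>x. p x * g x \<partial>m)\<^sup>2 \<le> (\<integral>x. h x * p x \<partial>m)"
proof -
  define q where "q n x = unit_clamp (G_seq h n x)" for n x
  note L = dominated_L2[OF h]
  have [measurable]: "potential m D \<E> h \<in> borel_measurable m" "G_seq h n \<in> borel_measurable m"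
    "h \<in> borel_measurable m" "g \<in> borel_measurable m" for n
    using h dominated_potential(1)[OF h] G_seq_measurable[OF L] reference_integrable
    by (auto simp: dominated_def)
  have [measurable]: "p \<in> borel_measurable m" "q n \<in> borel_measurable m" for n
    unfolding p_def q_def by measurable
  have bounds: "0 \<le> q n x" "\<bar>q n x\<bar> \<le> 1" for n x
    using unit_clamp_bounds by (auto simp: q_def)
  have approx: "(\<integral>x. q n x * g x \<partial>m)\<^sup>2 \<le> (\<integral>x. h x * q n x \<partial>m)" for n
  proof -
    let ?a = "1 / real (Suc n)"
    have u: "G_seq h n \<in> D" by (rule resolvent_dom[OF L]) simp
    have qD: "q n \<in> D" unfolding q_def using u by (rule unit_clamp_dom)
    have "\<E> (q n) (q n) \<le> \<E> (G_seq h n) (q n)"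
      unfolding q_def using u by (rule form_unit_clamp_le)
    also have "\<dots> \<le> form_shift ?a (G_seq h n) (q n)"
    proof -
      have "0 \<le> G_seq h n x * q n x" for x
        by (auto simp: q_def unit_clamp_def zero_le_mult_iff)
      then show ?thesis
        unfolding form_shift_def L2_inner_def by (auto intro!: mult_nonneg_nonneg)
    qed
    also have "\<dots> = (\<integral>x. h x * q n x \<partial>m)"
      using resolvent[OF L, of ?a] qD by (simp add: is_resolvent_def L2_inner_def)
    finally have "\<E> (q n) (q n) \<le> (\<integral>x. h x * q n x \<partial>m)" .
    moreover have "(\<integral>x. q n x * g x \<partial>m) \<le> sqrt (\<E> (q n) (q n))"
      using reference_energy[OF qD] bounds by (simp add: abs_of_nonneg)
    then have "(\<integral>x. q n x * g x \<partial>m)\<^sup>2 \<le> (sqrt (\<E> (q n) (q n)))\<^sup>2"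
      using bounds reference_nonneg by (intro power_mono integral_nonneg_AE) auto
    then have "(\<integral>x. q n x * g x \<partial>m)\<^sup>2 \<le> \<E> (q n) (q n)"
      using form_nonneg[OF qD] by simp
    ultimately show ?thesis by linarith
  qed
  have lim: "AE x in m. (\<lambda>n. q n x) \<longlonglongrightarrow> p x"
    using dominated_potential(2)[OF h] by eventually_elim
      (auto simp: q_def p_def unit_clamp_def intro!: tendsto_intros)
  have "(\<lambda>n. \<integral>x. q n x * g x \<partial>m) \<longlonglongrightarrow> (\<integral>x. p x * g x \<partial>m)"
  proof (rule integral_dominated_convergence[where w = g])
    show "AE x in m. (\<lambda>n. q n x * g x) \<longlonglongrightarrow> p x * g x"
      using lim by eventually_elim (intro tendsto_intros)
    show "AE x in m. norm (q n x * g x) \<le> g x" for n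
      using bounds reference_nonneg by (auto simp: abs_mult intro!: mult_left_le_one_le)
  qed (use reference_integrable in auto)
  moreover have "(\<lambda>n. \<integral>x. h x * q n x \<partial>m) \<longlonglongrightarrow> (\<integral>x. h x * p x \<partial>m)"
  proof (rule integral_dominated_convergence[where w = "\<lambda>x. \<bar>h x\<bar>"])
    show "AE x in m. (\<lambda>n. h x * q n x) \<longlonglongrightarrow> h x * p x"
      using lim by eventually_elim (intro tendsto_intros)
    show "AE x in m. norm (h x * q n x) \<le> \<bar>h x\<bar>" for n
      using bounds by (auto simp: abs_mult intro!: mult_right_le_one_le)
  qed (use dominated_integrable[OF h(1)] in auto)
  ultimately show ?thesis
    using approx by (intro LIMSEQ_le[OF tendsto_power]) auto
qed

subsection \<open>Potentials in the sense of duality\<close>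

text \<open>The equation \<open>w = GF\<close> in the sense of duality, which makes sense for \<open>F\<close> merely integrable.\<close>

definition is_dual_potential :: "('a \<Rightarrow> real) \<Rightarrow> ('a \<Rightarrow> real) \<Rightarrow> bool" where
  "is_dual_potential F w \<longleftrightarrow> integrable m F \<and> w \<in> borel_measurable m \<and>
     (\<forall>c k \<eta>. dominated c k \<eta> \<longrightarrow> c \<ge> 0 \<longrightarrow> integrable m (\<lambda>x. w x * \<eta> x) \<and>
        (\<integral>x. w x * \<eta> x \<partial>m) = (\<integral>x. F x * potential m D \<E> \<eta> x \<partial>m))"

text \<open>Let \<open>F\<^sub>j\<close> be \<open>F\<close> restricted to \<open>{|F| \<le> j g}\<close> within the \<open>j\<close>-th sublevel set. Testing the difference
  \<open>GF\<^sub>j - w\<close> with its own sign, weighted by the truncated \<open>g\<close>, bounds its weighted \<open>L\<^sup>1\<close> norm by a multiple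
  of \<open>\<parallel>F\<^sub>j - F\<parallel>\<^sub>1\<close>.\<close>

lemma dual_potential_approximation:
  assumes "is_dual_potential F w"
  obtains b j h where "\<And>n. dominated (b n) (j n) (h n)" "\<And>n. 0 \<le> b n"
    "\<And>n x. \<bar>h n x\<bar> \<le> \<bar>F x\<bar>" "AE x in m. (\<lambda>n. h n x) \<longlonglongrightarrow> F x"
    "AE x in m. (\<lambda>n. potential m D \<E> (h n) x) \<longlonglongrightarrow> w x"
proof -
  have F: "integrable m F" and w: "w \<in> borel_measurable m"
    and dual: "\<And>c k \<eta>. dominated c k \<eta> \<Longrightarrow> c \<ge> 0 \<Longrightarrow> integrable m (\<lambda>x. w x * \<eta> x) \<and>
      (\<integral>x. w x * \<eta> x \<partial>m) = (\<integral>x. F x * potential m D \<E> \<eta> x \<partial>m)"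
    using assms by (auto simp: is_dual_potential_def)
  have [measurable]: "F \<in> borel_measurable m" "w \<in> borel_measurable m" "g \<in> borel_measurable m"
    using F w reference_integrable by auto
  define T where "T j = {x \<in> sublevel j. \<bar>F x\<bar> \<le> real j * g x}" for j
  have T_sets [measurable]: "T j \<in> sets m" for j
  proof -
    have "T j = sublevel j \<inter> {x \<in> space m. \<bar>F x\<bar> \<le> real j * g x}"
      by (auto simp: T_def sublevel_def)
    then show ?thesis by simp
  qed
  define Fj where "Fj j x = F x * indicator (T j) x" for j x
  define v where "v j = potential m D \<E> (Fj j)" for j
  have Fj_dom: "dominated (real j) j (Fj j)" for j
    using reference_nonneg
    by (auto simp: dominated_def Fj_def[abs_def] truncated_reference_def T_def indicator_def)
  have Fj_int: "integrable m (Fj j)" for j using Fj_dom by (rule dominated_integrable)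
  have Fj_le: "\<bar>Fj j x\<bar> \<le> \<bar>F x\<bar>" for j x by (auto simp: Fj_def indicator_def)
  have v_meas [measurable]: "v j \<in> borel_measurable m" for j
    unfolding v_def by (rule dominated_potential(1)[OF Fj_dom]) simp
  have ev: "AE x in m. eventually (\<lambda>j. Fj j x = F x) sequentially"
    using AE_in_sublevel reference_pos
  proof eventually_elim
    case (elim x)
    then obtain k where k: "x \<in> sublevel k" by blast
    obtain l :: nat where l: "\<bar>F x\<bar> / g x \<le> real l" using real_arch_simple by blast
    have "Fj j x = F x" if "j \<ge> max k l" for j
    proof -
      have "\<bar>F x\<bar> / g x \<le> real j" using l that by linarith
      moreover have "x \<in> sublevel j" using k sublevel_mono[of k j] that by auto
      ultimately show ?thesis using elim(2) by (simp add: Fj_def T_def field_simps)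
    qed
    then show ?case unfolding eventually_sequentially by blast
  qed
  define \<epsilon> where "\<epsilon> j = (\<integral>x. \<bar>Fj j x - F x\<bar> \<partial>m)" for j
  have "\<epsilon> \<longlonglongrightarrow> (\<integral>x. 0 \<partial>m)"
    unfolding \<epsilon>_def
  proof (rule integral_dominated_convergence[where w = "\<lambda>x. 2 * \<bar>F x\<bar>"])
    show "AE x in m. (\<lambda>j. \<bar>Fj j x - F x\<bar>) \<longlonglongrightarrow> 0"
      using ev by eventually_elim (auto intro!: tendsto_eventually elim: eventually_mono)
    show "AE x in m. norm \<bar>Fj j x - F x\<bar> \<le> 2 * \<bar>F x\<bar>" for j
    proof (rule AE_I2)
      show "norm \<bar>Fj j x - F x\<bar> \<le> 2 * \<bar>F x\<bar>" for x using Fj_le[of j x] by simp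
    qed
  qed (use F Fj_int in auto)
  then have \<epsilon>: "\<epsilon> \<longlonglongrightarrow> 0" by simp
  have close: "integrable m (\<lambda>x. (v j x - w x) * truncated_reference k x) \<and>
      (\<integral>x. \<bar>(v j x - w x) * truncated_reference k x\<bar> \<partial>m) \<le> (real k + 1) * \<epsilon> j" for j k
  proof -
    define \<eta> where "\<eta> x = sgn (v j x - w x) * truncated_reference k x" for x
    have \<eta>: "dominated 1 k \<eta>"
      using truncated_reference_bounds(1)[of k] by (auto simp: dominated_def \<eta>_def[abs_def] abs_mult abs_sgn_eq)
    have ck: "dominated 1 k (truncated_reference k)"
      using truncated_reference_bounds(1)[of k] by (auto simp: dominated_def)
    have vint: "integrable m (\<lambda>x. v j x * \<theta> x)" if \<theta>: "dominated 1 k \<theta>" for \<theta>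
      using integrable_mult_potential[OF Fj_dom of_nat_0_le_iff dominated_integrable[OF \<theta>]]
      by (simp add: v_def mult.commute)
    have potb: "AE x in m. \<bar>potential m D \<E> \<eta> x\<bar> \<le> real k + 1"
      using dominated_potential(3)[OF \<eta>] by simp
    note potint = integrable_mult_potential[OF \<eta> zero_le_one]
    have "(\<integral>x. \<bar>(v j x - w x) * truncated_reference k x\<bar> \<partial>m) = (\<integral>x. v j x * \<eta> x - w x * \<eta> x \<partial>m)"
    proof (rule Bochner_Integration.integral_cong)
      fix x
      have "\<bar>(v j x - w x) * truncated_reference k x\<bar> = \<bar>v j x - w x\<bar> * truncated_reference k x"
        using truncated_reference_bounds(1)[of k x] by (simp add: abs_mult)
      also have "\<dots> = (v j x - w x) * \<eta> x"
        using mult_sgn_abs[of "v j x - w x"] abs_sgn[of "v j x - w x"]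
        by (simp add: \<eta>_def)
      finally show "\<bar>(v j x - w x) * truncated_reference k x\<bar> = v j x * \<eta> x - w x * \<eta> x"
        by (simp add: algebra_simps)
    qed simp
    also have "\<dots> = (\<integral>x. v j x * \<eta> x \<partial>m) - (\<integral>x. w x * \<eta> x \<partial>m)"
      using vint[OF \<eta>] dual[OF \<eta>] by (intro Bochner_Integration.integral_diff) auto
    also have "\<dots> = (\<integral>x. Fj j x * potential m D \<E> \<eta> x \<partial>m) - (\<integral>x. F x * potential m D \<E> \<eta> x \<partial>m)"
      using dual[OF \<eta>] potential_symmetric[OF Fj_dom[of j] _ \<eta>] by (simp add: v_def)
    also have "\<dots> = (\<integral>x. (Fj j x - F x) * potential m D \<E> \<eta> x \<partial>m)"
      using potint[OF Fj_int] potint[OF F]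
      by (subst Bochner_Integration.integral_diff[symmetric]) (auto simp: left_diff_distrib)
    also have "\<dots> \<le> (\<integral>x. (real k + 1) * \<bar>Fj j x - F x\<bar> \<partial>m)"
    proof (rule integral_mono_AE)
      show "integrable m (\<lambda>x. (Fj j x - F x) * potential m D \<E> \<eta> x)"
        using F Fj_int by (intro potint) auto
      show "AE x in m. (Fj j x - F x) * potential m D \<E> \<eta> x \<le> (real k + 1) * \<bar>Fj j x - F x\<bar>"
        using potb
      proof eventually_elim
        case (elim x)
        have "(Fj j x - F x) * potential m D \<E> \<eta> x \<le> \<bar>Fj j x - F x\<bar> * \<bar>potential m D \<E> \<eta> x\<bar>"
          by (metis abs_ge_self abs_mult)
        also have "\<dots> \<le> \<bar>Fj j x - F x\<bar> * (real k + 1)"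
          using elim by (intro mult_left_mono) auto
        finally show ?case by (simp add: mult.commute)
      qed
    qed (use F Fj_int in auto)
    finally have "(\<integral>x. \<bar>(v j x - w x) * truncated_reference k x\<bar> \<partial>m) \<le> (real k + 1) * \<epsilon> j"
      by (simp add: \<epsilon>_def)
    moreover have "integrable m (\<lambda>x. (v j x - w x) * truncated_reference k x)"
      using vint[OF ck] dual[OF ck] by (auto simp: left_diff_distrib)
    ultimately show ?thesis by blast
  qed
  have "\<exists>j\<ge>k. (real k + 1) * \<epsilon> j \<le> 1 / real (Suc k)" for k
  proof -
    have "(\<lambda>j. (real k + 1) * \<epsilon> j) \<longlonglongrightarrow> 0" using \<epsilon> by (rule tendsto_mult_right_zero)
    then have "eventually (\<lambda>j. (real k + 1) * \<epsilon> j < 1 / real (Suc k)) sequentially"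
      by (rule order_tendstoD) simp
    then have "eventually (\<lambda>j. (real k + 1) * \<epsilon> j < 1 / real (Suc k) \<and> j \<ge> k) sequentially"
      using eventually_ge_at_top by (rule eventually_conj)
    then show ?thesis by (auto dest!: eventually_happens intro: less_imp_le)
  qed
  \<comment> \<open>A diagonal choice: \<open>J k\<close> grows so fast that the bound \<open>k + 1\<close> of the \<open>k\<close>-th weight is
    absorbed. One subsequence then works for all weights at once, as the weight is eventually \<open>g x > 0\<close>.\<close>
  then obtain J where J: "\<And>k. J k \<ge> k" "\<And>k. (real k + 1) * \<epsilon> (J k) \<le> 1 / real (Suc k)" by metis
  define X where "X k x = (v (J k) x - w x) * truncated_reference k x" for k x
  have X_int: "integrable m (X k)" for k using close unfolding X_def by blast
  have "(\<lambda>k. \<integral>x. norm (X k x) \<partial>m) \<longlonglongrightarrow> 0"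
  proof (rule tendsto_sandwich[of "\<lambda>_. 0"])
    show "eventually (\<lambda>k. (\<integral>x. norm (X k x) \<partial>m) \<le> 1 / real (Suc k)) sequentially"
    proof (rule always_eventually, rule allI)
      fix k
      have "(\<integral>x. norm (X k x) \<partial>m) \<le> (real k + 1) * \<epsilon> (J k)"
        using close[of "J k" k] by (simp add: X_def)
      then show "(\<integral>x. norm (X k x) \<partial>m) \<le> 1 / real (Suc k)" using J(2) by (rule order_trans)
    qed
    show "(\<lambda>k. 1 / real (Suc k)) \<longlonglongrightarrow> 0"
      using LIMSEQ_inverse_real_of_nat by (simp add: inverse_eq_divide)
  qed auto
  from tendsto_L1_AE_subseq[OF X_int this] obtain r
    where r: "strict_mono r" "AE x in m. (\<lambda>n. X (r n) x) \<longlonglongrightarrow> 0" by blast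
  define i where "i n = J (r n)" for n
  have i: "filterlim i at_top sequentially"
  proof (rule filterlim_at_top_mono[OF filterlim_ident])
    show "eventually (\<lambda>n. n \<le> i n) sequentially"
      unfolding i_def using order_trans[OF seq_suble[OF r(1)] J(1)] by (intro always_eventually allI)
  qed
  have v_lim: "AE x in m. (\<lambda>n. v (i n) x) \<longlonglongrightarrow> w x"
    using r(2) AE_in_sublevel reference_pos
  proof eventually_elim
    case (elim x)
    then obtain k where k: "x \<in> sublevel k" by blast
    have eq: "X (r n) x / g x + w x = v (i n) x" if "n \<ge> k" for n
    proof -
      have "k \<le> r n" using seq_suble[OF r(1), of n] that by simp
      then have "x \<in> sublevel (r n)" using k sublevel_mono by blast
      then show ?thesis using elim(3) by (simp add: X_def truncated_reference_def i_def)
    qed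
    have "(\<lambda>n. X (r n) x / g x + w x) \<longlonglongrightarrow> 0 / g x + w x"
      using elim(1,3) by (intro tendsto_intros) auto
    then have "(\<lambda>n. X (r n) x / g x + w x) \<longlonglongrightarrow> w x" by simp
    then show ?case
      by (rule Lim_transform_eventually)
        (use eq in \<open>auto simp: eventually_sequentially\<close>)
  qed
  have ev_i: "AE x in m. (\<lambda>n. Fj (i n) x) \<longlonglongrightarrow> F x"
    using ev
  proof eventually_elim
    case (elim x)
    then have "(\<lambda>j. Fj j x) \<longlonglongrightarrow> F x" by (rule tendsto_eventually)
    then show ?case using i by (rule filterlim_compose)
  qed
  show thesis
    by (rule that[of "\<lambda>n. real (i n)" i "\<lambda>n. Fj (i n)"])
      (use Fj_dom Fj_le ev_i v_lim in \<open>simp_all add: v_def\<close>)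
qed

text \<open>The limit of the clamp inequalities reads \<open>(\<integral> \<psi>(w) g dm)\<^sup>2 \<le> \<integral> F \<psi>(w) dm\<close>, and \<open>F \<psi>(w) \<le> 0\<close> because
  \<open>\<psi>(w)\<close> vanishes unless \<open>w > 0\<close>.\<close>

lemma dual_potential_nonpos:
  assumes dual: "is_dual_potential F w" and sign: "\<And>x. F x * w x \<le> 0"
  shows "AE x in m. w x \<le> 0"
proof -
  obtain b j h where h: "\<And>n. dominated (b n) (j n) (h n)" "\<And>n. 0 \<le> b n"
    and h_le: "\<And>n x. \<bar>h n x\<bar> \<le> \<bar>F x\<bar>"
    and h_lim: "AE x in m. (\<lambda>n. h n x) \<longlonglongrightarrow> F x"
    and v_lim: "AE x in m. (\<lambda>n. potential m D \<E> (h n) x) \<longlonglongrightarrow> w x"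
    using dual_potential_approximation[OF dual] by blast
  have F: "integrable m F" using dual by (simp add: is_dual_potential_def)
  have [measurable]: "F \<in> borel_measurable m" "w \<in> borel_measurable m" "g \<in> borel_measurable m"
    "h n \<in> borel_measurable m" "potential m D \<E> (h n) \<in> borel_measurable m" for n
    using dual F h(1)[of n] reference_integrable dominated_potential(1)[OF h]
    by (auto simp: is_dual_potential_def dominated_def)
  define p where "p x = unit_clamp (w x)" for x
  define q where "q n x = unit_clamp (potential m D \<E> (h n) x)" for n x
  have [measurable]: "p \<in> borel_measurable m" "q n \<in> borel_measurable m" for n
    unfolding p_def q_def by measurable
  have q_lim: "AE x in m. (\<lambda>n. q n x) \<longlonglongrightarrow> p x"
    using v_lim by eventually_elim
      (auto simp: q_def p_def unit_clamp_def intro!: tendsto_intros)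
  have bounds: "0 \<le> p x" "0 \<le> q n x" "\<bar>q n x\<bar> \<le> 1" "\<bar>p x\<bar> \<le> 1" for n x
    using unit_clamp_bounds by (auto simp: p_def q_def)
  have lim1: "(\<lambda>n. \<integral>x. q n x * g x \<partial>m) \<longlonglongrightarrow> (\<integral>x. p x * g x \<partial>m)"
  proof (rule integral_dominated_convergence[where w = g])
    show "AE x in m. (\<lambda>n. q n x * g x) \<longlonglongrightarrow> p x * g x"
      using q_lim by eventually_elim (intro tendsto_intros)
    show "AE x in m. norm (q n x * g x) \<le> g x" for n
      using bounds reference_nonneg by (auto simp: abs_mult intro!: mult_left_le_one_le)
  qed (use reference_integrable in auto)
  have lim2: "(\<lambda>n. \<integral>x. h n x * q n x \<partial>m) \<longlonglongrightarrow> (\<integral>x. F x * p x \<partial>m)"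
  proof (rule integral_dominated_convergence[where w = "\<lambda>x. \<bar>F x\<bar>"])
    show "AE x in m. (\<lambda>n. h n x * q n x) \<longlonglongrightarrow> F x * p x"
      using q_lim h_lim by eventually_elim (intro tendsto_intros)
    show "AE x in m. norm (h n x * q n x) \<le> \<bar>F x\<bar>" for n
    proof (rule AE_I2)
      fix x
      have "\<bar>h n x\<bar> * \<bar>q n x\<bar> \<le> \<bar>F x\<bar> * 1"
        using h_le bounds by (intro mult_mono) auto
      then show "norm (h n x * q n x) \<le> \<bar>F x\<bar>" by (simp add: abs_mult)
    qed
  qed (use F in auto)
  have "(\<integral>x. p x * g x \<partial>m)\<^sup>2 \<le> (\<integral>x. F x * p x \<partial>m)"
    using potential_clamp_inequality[OF h]
    by (intro LIMSEQ_le[OF tendsto_power[OF lim1] lim2]) (auto simp: q_def)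
  also have "\<dots> \<le> 0"
  proof -
    have "F x * p x \<le> 0" for x
      using sign[of x] by (auto simp: p_def unit_clamp_def mult_le_0_iff)
    then have "0 \<le> (\<integral>x. - (F x * p x) \<partial>m)"
      by (intro Bochner_Integration.integral_nonneg) simp
    then show ?thesis by simp
  qed
  finally have "(\<integral>x. p x * g x \<partial>m) = 0" by simp
  moreover have "integrable m (\<lambda>x. p x * g x)"
    by (rule Bochner_Integration.integrable_bound[OF reference_integrable])
      (use bounds reference_nonneg in \<open>auto simp: abs_mult intro!: mult_left_le_one_le\<close>)
  ultimately have "AE x in m. p x * g x = 0"
    using bounds reference_nonneg by (subst (asm) integral_nonneg_eq_0_iff_AE) auto
  then show ?thesis
    using reference_pos by eventually_elim (auto simp: p_def unit_clamp_def)
qed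

end

section \<open>Uniqueness of solutions\<close>

theorem corollary3p7:
  fixes m :: "'a::{metric_space, second_countable_topology} measure"
    and D :: "('a \<Rightarrow> real) set"
    and \<E> :: "('a \<Rightarrow> real) \<Rightarrow> ('a \<Rightarrow> real) \<Rightarrow> real"
    and f :: "'a \<Rightarrow> real \<Rightarrow> real"
    and \<mu> :: "'a set \<Rightarrow> real"
    and u1 u2 :: "'a \<Rightarrow> real"
  assumes "locally_compact_space (euclidean :: 'a topology)"
    and "radon_measure m"
    and "measure_support m = UNIV"
    and "regular_symmetric_dirichlet_form m D \<E>"
    and "transient_form m D \<E>"
    and "\<mu> \<in> diffuse_measures m D \<E>"
    and "caratheodory f"
    and "\<And>x y1 y2. (f x y1 - f x y2) * (y1 - y2) \<le> 0"
    and "duality_solution m D \<E> f \<mu> u1"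
    and "duality_solution m D \<E> f \<mu> u2"
  shows "AE x in m. u1 x = u2 x"
proof -
  interpret symmetric_dirichlet_form m D \<E>
    using assms(4) by (simp add: regular_symmetric_dirichlet_form_def)
  obtain g c where g: "integrable m g" "\<And>x. \<bar>g x\<bar> \<le> c" "AE x in m. g x > 0"
      "\<And>u. u \<in> D \<Longrightarrow> (\<integral>x. \<bar>u x\<bar> * g x \<partial>m) \<le> sqrt (\<E> u u)"
    using assms(5) by (auto simp: transient_form_def)
  interpret transient_dirichlet_form m D \<E> "\<lambda>x. max (g x) 0" c
  proof
    show "integrable m (\<lambda>x. max (g x) 0)" using g(1) by auto
    show "max (g x) 0 \<le> c" for x using g(2)[of x] by auto
    show "AE x in m. 0 < max (g x) 0" using g(3) by auto
    fix u assume u: "u \<in> D"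
    have "(\<integral>x. \<bar>u x\<bar> * max (g x) 0 \<partial>m) = (\<integral>x. \<bar>u x\<bar> * g x \<partial>m)"
      by (rule integral_cong_AE)
        (use g(1,3) dom_measurable[OF u] in \<open>auto simp: max_def\<close>)
    then show "(\<integral>x. \<bar>u x\<bar> * max (g x) 0 \<partial>m) \<le> sqrt (\<E> u u)" using g(4)[OF u] by simp
  qed auto
  have nonpos: "AE x in m. u x - u' x \<le> 0"
    if u: "duality_solution m D \<E> f \<mu> u" and u': "duality_solution m D \<E> f \<mu> u'" for u u'
  proof (rule dual_potential_nonpos)
    let ?F = "\<lambda>x. f x (u x) - f x (u' x)"
    have fint: "integrable m (\<lambda>x. f x (u x))" "integrable m (\<lambda>x. f x (u' x))"
      using u u' by (auto simp: duality_solution_def)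
    show "?F x * (u x - u' x) \<le> 0" for x by (rule assms(8))
    show "is_dual_potential ?F (\<lambda>x. u x - u' x)"
      unfolding is_dual_potential_def
    proof (intro conjI allI impI)
      show "integrable m ?F" using fint by auto
      show "(\<lambda>x. u x - u' x) \<in> borel_measurable m"
        using u u' by (auto simp: duality_solution_def)
    next
      fix b k \<eta> assume \<eta>: "dominated b k \<eta>" "b \<ge> 0"
      have bnd: "\<exists>c::real. AE x in m. potential_nn m D \<E> (\<lambda>y. ennreal \<bar>\<eta> y\<bar>) x \<le> ennreal c"
        using dominated_potential_nn_bound[OF dominated_abs[OF \<eta>(1)] \<eta>(2)] by auto
      have sol: "integrable m (\<lambda>x. z x * \<eta> x)"
        "(\<integral>x. z x * \<eta> x \<partial>m) = (\<integral>x. f x (z x) * potential m D \<E> \<eta> x \<partial>m) +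
            signed_integral \<mu> (qc_version m D \<E> (potential m D \<E> \<eta>))"
        if "duality_solution m D \<E> f \<mu> z" for z
        using that dominated_integrable[OF \<eta>(1)] bnd by (auto simp: duality_solution_def)
      show "integrable m (\<lambda>x. (u x - u' x) * \<eta> x)"
        "(\<integral>x. (u x - u' x) * \<eta> x \<partial>m) = (\<integral>x. ?F x * potential m D \<E> \<eta> x \<partial>m)"
        using sol[OF u] sol[OF u'] integrable_mult_potential[OF \<eta> fint(1)]
          integrable_mult_potential[OF \<eta> fint(2)]
        by (simp_all add: left_diff_distrib)
    qed
  qed
  from nonpos[OF assms(9,10)] nonpos[OF assms(10,9)] show ?thesis
    by eventually_elim auto
qed

end
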